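(* For any $0<\theta\le1$, one has the convergence in probability $\mathcal M_{\theta,n}\to\mathcal M_\theta$ as $n\to\infty$, where $$\mathcal M_{\theta,n}=(\sqrt{\log n})^{\mathbf 1\{\theta=1\}}\,\frac{\Gamma(\theta+1)}{n^\theta}\sum_{q=0}^n|c_q|^2 .$$
   Context: Let $(\mathcal N_k)_{k\ge1}$ be i.i.d. standard complex normal random variables ($\mathbb{E}\mathcal N_k=0$, $\mathbb{E}\mathcal N_k^2=0$, $\mathbb{E}|\mathcal N_k|^2=1$) and let $G^{\mathbb C}(z)=\sum_{k\ge1}\frac{z^k}{\sqrt k}\mathcal N_k$, $G(z)=2\,\mathrm{Re}\,G^{\mathbb C}(z)$ for $|z|<1$. For $\theta>0$ and $n\ge0$, $c_n$ is the coefficient of $z^n$ in the power series expansion of $e^{\sqrt\theta G^{\mathbb C}(z)}$ at $z=0$. For $\theta\in(0,1)$, $\mathrm{GMC}_\theta$ is the random measure on $[0,2\pi)$ given by $\mathrm{GMC}_\theta(d\vartheta)=\lim_{r\to1^-}(1-r^2)^\theta e^{\sqrt\theta G(re^{i\vartheta})}d\vartheta$, and for $\theta=1$, $\mathrm{GMC}_1(d\vartheta)=\lim_{r\to1^-}\sqrt{\log\frac1{1-r^2}}\,(1-r^2)e^{G(re^{i\vartheta})}d\vartheta$; these limits exist in probability in the weak-* sense. The total mass is $\mathcal M_\theta=\frac1{2\pi}\int_0^{2\pi}\mathrm{GMC}_\theta(d\vartheta)$, defined on the same probability space as the $c_n$. *)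

theory Defs
  imports "HOL-Probability.Probability" "HOL-Complex_Analysis.Complex_Analysis"
begin

definition std_complex_normal :: "'a measure \<Rightarrow> ('a \<Rightarrow> complex) \<Rightarrow> bool" where
  "std_complex_normal M X \<longleftrightarrow>
     prob_space.indep_var M borel (\<lambda>\<omega>. Re (X \<omega>)) borel (\<lambda>\<omega>. Im (X \<omega>)) \<and>
     distributed M lborel (\<lambda>\<omega>. Re (X \<omega>)) (normal_density 0 (sqrt (1 / 2))) \<and>
     distributed M lborel (\<lambda>\<omega>. Im (X \<omega>)) (normal_density 0 (sqrt (1 / 2)))"

text \<open>The normalisation E X = 0, E X^2 = 0, E |X|^2 = 1:\<close>

lemma (in prob_space) std_complex_normal_moments:
  assumes "std_complex_normal M X"
  shows "expectation X = 0"
    and "expectation (\<lambda>\<omega>. (X \<omega>)\<^sup>2) = 0"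
    and "expectation (\<lambda>\<omega>. (cmod (X \<omega>))\<^sup>2) = 1"
proof -
  let ?R = "\<lambda>\<omega>. Re (X \<omega>)" and ?I = "\<lambda>\<omega>. Im (X \<omega>)"
  have ind: "indep_var borel ?R borel ?I"
    and dR: "distributed M lborel ?R (normal_density 0 (sqrt (1/2)))"
    and dI: "distributed M lborel ?I (normal_density 0 (sqrt (1/2)))"
    using assms by (auto simp: std_complex_normal_def)
  have s: "0 < sqrt (1/2 :: real)" by simp
  have key: "integrable M Y \<and> expectation Y = 0 \<and> integrable M (\<lambda>\<omega>. (Y \<omega>)\<^sup>2)
      \<and> expectation (\<lambda>\<omega>. (Y \<omega>)\<^sup>2) = 1/2"
    if d: "distributed M lborel Y (normal_density 0 (sqrt (1/2)))" for Y :: "'a \<Rightarrow> real"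
  proof -
    have e0: "expectation Y = 0"
      by (rule normal_distributed_expectation[OF s d])
    have v: "variance Y = (sqrt (1/2))\<^sup>2"
      by (rule normal_distributed_variance[OF s d])
    have i1: "integrable M Y"
      using distributed_integrable[OF d, of "\<lambda>x. x"] integrable_normal_moment[OF s, of 0 1]
      by simp
    have i2: "integrable M (\<lambda>\<omega>. (Y \<omega>)\<^sup>2)"
      using distributed_integrable[OF d, of "\<lambda>x. x\<^sup>2"] integrable_normal_moment[OF s, of 0 2]
      by simp
    show ?thesis using e0 v i1 i2 by (simp add: real_sqrt_divide power_divide)
  qed
  note R = key[OF dR] and I = key[OF dI]
  have iX: "integrable M X" and eX: "expectation X = Complex 0 0"
  proof -
    have "X = (\<lambda>\<omega>. complex_of_real (?R \<omega>) + \<i> * complex_of_real (?I \<omega>))"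
      by (rule ext) (rule complex_eq)
    moreover have "integrable M (\<lambda>\<omega>. complex_of_real (?R \<omega>) + \<i> * complex_of_real (?I \<omega>))"
      using R I by (intro Bochner_Integration.integrable_add integrable_mult_right integrable_of_real) auto
    ultimately show iX: "integrable M X" by simp
    show "expectation X = Complex 0 0"
      using R I integral_Re[OF iX] integral_Im[OF iX] by (intro complex_eqI) auto
  qed
  then show "expectation X = 0" by (simp add: complex_eq_iff)
  have iRI: "integrable M (\<lambda>\<omega>. ?R \<omega> * ?I \<omega>)" and eRI: "expectation (\<lambda>\<omega>. ?R \<omega> * ?I \<omega>) = 0"
    using indep_var_integrable[OF ind] indep_var_lebesgue_integral[OF ind] R I by auto
  have sq: "(\<lambda>\<omega>. (X \<omega>)\<^sup>2) = (\<lambda>\<omega>. complex_of_real ((?R \<omega>)\<^sup>2 - (?I \<omega>)\<^sup>2)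
       + \<i> * complex_of_real (2 * (?R \<omega> * ?I \<omega>)))"
    by (rule ext) (simp add: complex_eq_iff power2_eq_square)
  have iA: "integrable M (\<lambda>\<omega>. complex_of_real ((?R \<omega>)\<^sup>2 - (?I \<omega>)\<^sup>2))"
    and iB: "integrable M (\<lambda>\<omega>. \<i> * complex_of_real (2 * (?R \<omega> * ?I \<omega>)))"
    using R I iRI by (intro integrable_of_real integrable_mult_right Bochner_Integration.integrable_diff; auto)+
  have "expectation (\<lambda>\<omega>. complex_of_real ((?R \<omega>)\<^sup>2 - (?I \<omega>)\<^sup>2)) = 0"
    using R I by (subst integral_complex_of_real) simp
  moreover have "expectation (\<lambda>\<omega>. \<i> * complex_of_real (2 * (?R \<omega> * ?I \<omega>))) = 0"
    using eRI iRI
    by (simp only: integral_mult_right_zero integral_complex_of_real) simp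
  ultimately show "expectation (\<lambda>\<omega>. (X \<omega>)\<^sup>2) = 0"
    unfolding sq using iA iB by (subst Bochner_Integration.integral_add) auto
  show "expectation (\<lambda>\<omega>. (cmod (X \<omega>))\<^sup>2) = 1"
    using R I by (simp add: cmod_power2)
qed

text \<open>The value of \<open>N\<close> at index 0 is irrelevant throughout.\<close>

definition iid_std_complex_normal :: "'a measure \<Rightarrow> (nat \<Rightarrow> 'a \<Rightarrow> complex) \<Rightarrow> bool" where
  "iid_std_complex_normal M N \<longleftrightarrow>
     prob_space.indep_vars M (\<lambda>_. borel) N {1..} \<and> (\<forall>k\<ge>1. std_complex_normal M (N k))"

text \<open>The series converges in the whole open unit disc almost surely. On the exceptional null
  event \<open>GC\<close> is set to 0, so that it is holomorphic in the disc for every \<open>\<omega>\<close>.\<close>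

definition GC :: "(nat \<Rightarrow> 'a \<Rightarrow> complex) \<Rightarrow> 'a \<Rightarrow> complex \<Rightarrow> complex" where
  "GC N \<omega> z =
     (if \<forall>w\<in>ball 0 1. summable (\<lambda>k. w ^ Suc k / of_real (sqrt (real (Suc k))) * N (Suc k) \<omega>)
      then (\<Sum>k. z ^ Suc k / of_real (sqrt (real (Suc k))) * N (Suc k) \<omega>) else 0)"

definition G :: "(nat \<Rightarrow> 'a \<Rightarrow> complex) \<Rightarrow> 'a \<Rightarrow> complex \<Rightarrow> real" where
  "G N \<omega> z = 2 * Re (GC N \<omega> z)"

definition c :: "(nat \<Rightarrow> 'a \<Rightarrow> complex) \<Rightarrow> real \<Rightarrow> nat \<Rightarrow> 'a \<Rightarrow> complex" where
  "c N \<theta> n \<omega> = fps_nth (fps_expansion (\<lambda>z. exp (of_real (sqrt \<theta>) * GC N \<omega> z)) 0) n"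

text \<open>Measurability is required explicitly since \<^const>\<open>measure\<close> is 0 on non-measurable sets.\<close>

definition tendsto_in_prob ::
    "'a measure \<Rightarrow> ('i \<Rightarrow> 'a \<Rightarrow> real) \<Rightarrow> ('a \<Rightarrow> real) \<Rightarrow> 'i filter \<Rightarrow> bool" where
  "tendsto_in_prob M X Y F \<longleftrightarrow>
     (\<forall>\<^sub>F i in F. X i \<in> borel_measurable M) \<and> Y \<in> borel_measurable M \<and>
     (\<forall>\<epsilon>>0. ((\<lambda>i. measure M {\<omega> \<in> space M. \<bar>X i \<omega> - Y \<omega>\<bar> > \<epsilon>}) \<longlongrightarrow> 0) F)"

definition random_measure :: "'a measure \<Rightarrow> 'b measure \<Rightarrow> ('a \<Rightarrow> 'b measure) \<Rightarrow> bool" where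
  "random_measure M S \<mu> \<longleftrightarrow>
     (\<forall>\<omega>\<in>space M. sets (\<mu> \<omega>) = sets S \<and> finite_measure (\<mu> \<omega>)) \<and>
     (\<forall>A\<in>sets S. (\<lambda>\<omega>. emeasure (\<mu> \<omega>) A) \<in> borel_measurable M)"

definition gmc_approx ::
    "(nat \<Rightarrow> 'a \<Rightarrow> complex) \<Rightarrow> real \<Rightarrow> real \<Rightarrow> 'a \<Rightarrow> real measure" where
  "gmc_approx N \<theta> r \<omega> =
     density (restrict_space lborel {0..<2 * pi})
       (\<lambda>t. ennreal ((if \<theta> = 1 then sqrt (ln (1 / (1 - r\<^sup>2))) else 1)
              * (1 - r\<^sup>2) powr \<theta> * exp (sqrt \<theta> * G N \<omega> (of_real r * cis t))))"

text \<open>\<open>is_GMC M N \<theta> \<mu>\<close>: the random measure \<open>\<mu>\<close> is the limit, in probability in the weak-* sense,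
  of \<open>gmc_approx N \<theta> r\<close> as \<open>r\<close> tends to 1 from below. The interval is identified with the unit
  circle via \<^const>\<open>cis\<close>, so the test functions are the continuous functions on the circle.
  Such a limit is unique up to a null event.\<close>

definition is_GMC ::
    "'a measure \<Rightarrow> (nat \<Rightarrow> 'a \<Rightarrow> complex) \<Rightarrow> real \<Rightarrow> ('a \<Rightarrow> real measure) \<Rightarrow> bool" where
  "is_GMC M N \<theta> \<mu> \<longleftrightarrow>
     random_measure M (restrict_space borel {0..<2 * pi}) \<mu> \<and>
     (\<forall>f :: complex \<Rightarrow> real. continuous_on (sphere 0 1) f \<longrightarrow>
        tendsto_in_prob M
          (\<lambda>r \<omega>. \<integral>t. f (cis t) \<partial>gmc_approx N \<theta> r \<omega>)
          (\<lambda>\<omega>. \<integral>t. f (cis t) \<partial>\<mu> \<omega>)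
          (at_left 1))"

definition total_mass :: "('a \<Rightarrow> real measure) \<Rightarrow> 'a \<Rightarrow> real" where
  "total_mass \<mu> \<omega> = 1 / (2 * pi) * measure (\<mu> \<omega>) {0..<2 * pi}"

definition approx_mass :: "(nat \<Rightarrow> 'a \<Rightarrow> complex) \<Rightarrow> real \<Rightarrow> nat \<Rightarrow> 'a \<Rightarrow> real" where
  "approx_mass N \<theta> n \<omega> =
     (if \<theta> = 1 then sqrt (ln (real n)) else 1) * (Gamma (\<theta> + 1) / real n powr \<theta>)
       * (\<Sum>q=0..n. (cmod (c N \<theta> q \<omega>))\<^sup>2)"

end

theory Submission
  imports Defs "HOL-Real_Asymp.Real_Asymp"
begin

text \<open>Testing the weak convergence defining the chaos measure against the constant 1 and applying
  Parseval on the circle of radius \<open>r = exp (- j / (2 n))\<close> shows that the normalised Laplace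
  transforms \<open>n powr (- \<theta>) * (\<Sum>q. \<bar>c\<^sub>q\<bar>\<^sup>2 * exp (- j * q / n))\<close> (with an extra
  factor \<open>sqrt (ln n)\<close> if \<open>\<theta> = 1\<close>) converge in probability to
  \<open>j powr (- \<theta>)\<close> times the total mass, for each fixed \<open>j\<close>. As the weights \<open>\<bar>c\<^sub>q\<bar>\<^sup>2\<close> are
  nonnegative, Karamata's proof of the Hardy-Littlewood Tauberian theorem applies: the cutoff
  \<open>q \<le> n\<close> is sandwiched between polynomials in \<open>exp (- q / n)\<close>. Each bound involves only
  finitely many \<open>j\<close>, so the argument can be run directly with convergence in probability.\<close>

section \<open>Convergence in probability\<close>

context prob_space begin

lemma tendsto_in_probI:
  assumes "\<forall>\<^sub>F i in F. X i \<in> borel_measurable M" "Y \<in> borel_measurable M"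
    and "\<And>\<epsilon> \<delta>. \<epsilon> > 0 \<Longrightarrow> \<delta> > 0 \<Longrightarrow> \<forall>\<^sub>F i in F. prob {\<omega> \<in> space M. \<bar>X i \<omega> - Y \<omega>\<bar> > \<epsilon>} < \<delta>"
  shows "tendsto_in_prob M X Y F"
  unfolding tendsto_in_prob_def
proof (intro conjI allI impI)
  fix \<epsilon> :: real assume "\<epsilon> > 0"
  then show "((\<lambda>i. prob {\<omega> \<in> space M. \<epsilon> < \<bar>X i \<omega> - Y \<omega>\<bar>}) \<longlongrightarrow> 0) F"
    using assms(3) by (intro tendstoI) auto
qed (use assms in auto)

lemma tendsto_in_probD:
  assumes "tendsto_in_prob M X Y F" "\<epsilon> > 0" "\<delta> > 0"
  shows "\<forall>\<^sub>F i in F. prob {\<omega> \<in> space M. \<bar>X i \<omega> - Y \<omega>\<bar> > \<epsilon>} < \<delta>"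
  using assms unfolding tendsto_in_prob_def by (auto intro: order_tendstoD(2))

lemma tendsto_in_prob_cong:
  assumes "tendsto_in_prob M X Y F"
    and "\<forall>\<^sub>F i in F. \<forall>\<omega>\<in>space M. X i \<omega> = X' i \<omega>" "\<And>\<omega>. \<omega> \<in> space M \<Longrightarrow> Y \<omega> = Y' \<omega>"
  shows "tendsto_in_prob M X' Y' F"
proof (rule tendsto_in_probI)
  show "\<forall>\<^sub>F i in F. X' i \<in> borel_measurable M"
  proof -
    have "\<forall>\<^sub>F i in F. X i \<in> borel_measurable M"
      using assms(1) by (simp add: tendsto_in_prob_def)
    with assms(2) show ?thesis
    proof eventually_elim
      case (elim i)
      then show ?case using measurable_cong[of M "X i" "X' i"] by blast
    qed
  qed
  show "Y' \<in> borel_measurable M"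
    using assms(1,3) measurable_cong[of M Y Y'] unfolding tendsto_in_prob_def by blast
  fix \<epsilon> \<delta> :: real assume "\<epsilon> > 0" "\<delta> > 0"
  from tendsto_in_probD[OF assms(1) this] assms(2)
  show "\<forall>\<^sub>F i in F. prob {\<omega> \<in> space M. \<bar>X' i \<omega> - Y' \<omega>\<bar> > \<epsilon>} < \<delta>"
  proof eventually_elim
    case (elim i)
    then have "{\<omega> \<in> space M. \<bar>X' i \<omega> - Y' \<omega>\<bar> > \<epsilon>} = {\<omega> \<in> space M. \<bar>X i \<omega> - Y \<omega>\<bar> > \<epsilon>}"
      using assms(3) by auto
    with elim show ?case by simp
  qed
qed

lemma tendsto_in_prob_compose:
  assumes "tendsto_in_prob M X Y F" "filterlim r F F'"
  shows "tendsto_in_prob M (\<lambda>i. X (r i)) Y F'"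
  unfolding tendsto_in_prob_def
proof (intro conjI allI impI)
  show "\<forall>\<^sub>F i in F'. X (r i) \<in> borel_measurable M"
    by (rule eventually_compose_filterlim[OF _ assms(2)])
       (use assms(1) in \<open>simp add: tendsto_in_prob_def\<close>)
  show "Y \<in> borel_measurable M"
    using assms(1) by (simp add: tendsto_in_prob_def)
  fix \<epsilon> :: real assume "\<epsilon> > 0"
  then have "((\<lambda>i. prob {\<omega> \<in> space M. \<bar>X i \<omega> - Y \<omega>\<bar> > \<epsilon>}) \<longlongrightarrow> 0) F"
    using assms(1) by (simp add: tendsto_in_prob_def)
  from filterlim_compose[OF this assms(2)]
  show "((\<lambda>i. prob {\<omega> \<in> space M. \<bar>X (r i) \<omega> - Y \<omega>\<bar> > \<epsilon>}) \<longlongrightarrow> 0) F'" .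
qed

text \<open>Tightness of a single real random variable: the events decrease to the empty set, so
  continuity from above applies. It turns errors proportional to \<open>Y\<close> into absolute
  ones.\<close>

lemma prob_abs_tail:
  assumes [measurable]: "Y \<in> borel_measurable M" and "\<delta> > (0::real)"
  obtains K where "K > 0" "prob {\<omega> \<in> space M. \<bar>Y \<omega>\<bar> > (K::real)} < \<delta>"
proof -
  define A where "A n = {\<omega> \<in> space M. \<bar>Y \<omega>\<bar> > real n}" for n
  have "(\<lambda>n. prob (A n)) \<longlonglongrightarrow> prob (\<Inter>n. A n)"
    by (intro finite_Lim_measure_decseq) (auto simp: A_def decseq_def)
  also have "(\<Inter>n. A n) = {}"
  proof -
    have "\<exists>n. \<not> \<bar>Y \<omega>\<bar> > real n" for \<omega>
      using reals_Archimedean2[of "\<bar>Y \<omega>\<bar>"] by (meson less_asym)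
    then show ?thesis by (auto simp: A_def)
  qed
  finally have "\<forall>\<^sub>F n in sequentially. prob (A n) < \<delta>"
    using \<open>\<delta> > 0\<close> by (intro order_tendstoD) auto
  with eventually_gt_at_top[of 0] have "\<forall>\<^sub>F n in sequentially. n > 0 \<and> prob (A n) < \<delta>"
    by eventually_elim auto
  then obtain n where "n > 0" "prob (A n) < \<delta>"
    by (auto simp: eventually_sequentially)
  then show ?thesis by (intro that[of "real n"]) (auto simp: A_def)
qed

lemma prob_le_union2:
  assumes "A \<subseteq> B \<union> C" "B \<in> events" "C \<in> events"
  shows "prob A \<le> prob B + prob C"
proof -
  have "prob A \<le> prob (B \<union> C)"
    using assms by (intro finite_measure_mono) auto
  also have "\<dots> \<le> prob B + prob C"
    using assms by (intro measure_Un_le)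
  finally show ?thesis .
qed

lemma tendsto_in_prob_add:
  assumes "tendsto_in_prob M X Y F" "tendsto_in_prob M X' Y' F"
  shows "tendsto_in_prob M (\<lambda>i \<omega>. X i \<omega> + X' i \<omega>) (\<lambda>\<omega>. Y \<omega> + Y' \<omega>) F"
proof (rule tendsto_in_probI)
  have mX: "\<forall>\<^sub>F i in F. X i \<in> borel_measurable M" and mX': "\<forall>\<^sub>F i in F. X' i \<in> borel_measurable M"
    and [measurable]: "Y \<in> borel_measurable M" "Y' \<in> borel_measurable M"
    using assms by (auto simp: tendsto_in_prob_def)
  show "\<forall>\<^sub>F i in F. (\<lambda>\<omega>. X i \<omega> + X' i \<omega>) \<in> borel_measurable M"
    using mX mX' by eventually_elim auto
  show "(\<lambda>\<omega>. Y \<omega> + Y' \<omega>) \<in> borel_measurable M" by measurable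
  fix \<epsilon> \<delta> :: real assume e: "\<epsilon> > 0" "\<delta> > 0"
  then have e2: "\<epsilon>/2 > 0" "\<delta>/2 > 0" by auto
  from tendsto_in_probD[OF assms(1) e2] tendsto_in_probD[OF assms(2) e2] mX mX'
  show "\<forall>\<^sub>F i in F. prob {\<omega> \<in> space M. \<bar>X i \<omega> + X' i \<omega> - (Y \<omega> + Y' \<omega>)\<bar> > \<epsilon>} < \<delta>"
  proof eventually_elim
    case (elim i)
    note [measurable] = elim(3,4)
    have "prob {\<omega> \<in> space M. \<bar>X i \<omega> + X' i \<omega> - (Y \<omega> + Y' \<omega>)\<bar> > \<epsilon>} \<le>
      prob {\<omega> \<in> space M. \<bar>X i \<omega> - Y \<omega>\<bar> > \<epsilon>/2} + prob {\<omega> \<in> space M. \<bar>X' i \<omega> - Y' \<omega>\<bar> > \<epsilon>/2}"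
    proof (rule prob_le_union2)
      have "\<bar>x - y\<bar> > \<epsilon>/2 \<or> \<bar>x' - y'\<bar> > \<epsilon>/2" if "\<bar>x + x' - (y + y')\<bar> > \<epsilon>" for x x' y y' :: real
        using that by linarith
      then show "{\<omega> \<in> space M. \<bar>X i \<omega> + X' i \<omega> - (Y \<omega> + Y' \<omega>)\<bar> > \<epsilon>} \<subseteq>
        {\<omega> \<in> space M. \<bar>X i \<omega> - Y \<omega>\<bar> > \<epsilon>/2} \<union> {\<omega> \<in> space M. \<bar>X' i \<omega> - Y' \<omega>\<bar> > \<epsilon>/2}"
        by blast
    qed auto
    with elim show ?case by linarith
  qed
qed

lemma tendsto_in_prob_const:
  "Y \<in> borel_measurable M \<Longrightarrow> tendsto_in_prob M (\<lambda>i. Y) Y F"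
  by (simp add: tendsto_in_prob_def)

lemma tendsto_in_prob_sum:
  assumes "finite I" "\<And>j. j \<in> I \<Longrightarrow> tendsto_in_prob M (X j) (Y j) F"
  shows "tendsto_in_prob M (\<lambda>i \<omega>. \<Sum>j\<in>I. X j i \<omega>) (\<lambda>\<omega>. \<Sum>j\<in>I. Y j \<omega>) F"
  using assms
proof (induction I rule: finite_induct)
  case empty
  then show ?case by (simp add: tendsto_in_prob_const)
next
  case (insert x I)
  then show ?case by (simp add: tendsto_in_prob_add)
qed

text \<open>The factors are deterministic. In
  \<open>a i * x - b * y = a i * (x - y) + (a i - b) * y\<close> the first term is controlled by
  convergence in probability, the second by tightness of \<open>Y\<close>.\<close>

lemma tendsto_in_prob_mult:
  fixes a :: "'i \<Rightarrow> real"
  assumes "tendsto_in_prob M X Y F" "(a \<longlongrightarrow> b) F"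
  shows "tendsto_in_prob M (\<lambda>i \<omega>. a i * X i \<omega>) (\<lambda>\<omega>. b * Y \<omega>) F"
proof (rule tendsto_in_probI)
  have mX: "\<forall>\<^sub>F i in F. X i \<in> borel_measurable M"
    and mY[measurable]: "Y \<in> borel_measurable M"
    using assms by (auto simp: tendsto_in_prob_def)
  show "\<forall>\<^sub>F i in F. (\<lambda>\<omega>. a i * X i \<omega>) \<in> borel_measurable M"
    using mX by eventually_elim auto
  show "(\<lambda>\<omega>. b * Y \<omega>) \<in> borel_measurable M" by measurable
  fix \<epsilon> \<delta> :: real assume e: "\<epsilon> > 0" "\<delta> > 0"
  obtain K where K: "K > 0" "prob {\<omega> \<in> space M. \<bar>Y \<omega>\<bar> > K} < \<delta>/2"
    using prob_abs_tail[OF mY, of "\<delta>/2"] e by auto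
  \<comment> \<open>Half of the error budget:
    \<open>(\<bar>b\<bar> + 1) * \<epsilon>' = \<epsilon> / 2\<close>, where
    \<open>\<bar>b\<bar> + 1\<close> bounds \<open>\<bar>a i\<bar>\<close> as soon as
    \<open>a i\<close> is within 1 of \<open>b\<close>.\<close>
  define \<epsilon>' where "\<epsilon>' = \<epsilon> / (2 * (\<bar>b\<bar> + 1))"
  have "\<epsilon>' > 0" using e by (simp add: \<epsilon>'_def field_simps)
  have "\<forall>\<^sub>F i in F. dist (a i) b < min 1 (\<epsilon> / (2*K))"
    using assms(2) e K by (intro tendstoD) auto
  with tendsto_in_probD[OF assms(1) \<open>\<epsilon>' > 0\<close>, of "\<delta>/2"] mX e
  have "\<forall>\<^sub>F i in F. prob {\<omega> \<in> space M. \<bar>X i \<omega> - Y \<omega>\<bar> > \<epsilon>'} < \<delta>/2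
      \<and> dist (a i) b < min 1 (\<epsilon> / (2*K)) \<and> X i \<in> borel_measurable M"
    by (intro eventually_conj) auto
  then show "\<forall>\<^sub>F i in F. prob {\<omega> \<in> space M. \<bar>a i * X i \<omega> - b * Y \<omega>\<bar> > \<epsilon>} < \<delta>"
  proof eventually_elim
    case (elim i)
    then have [measurable]: "X i \<in> borel_measurable M" by simp
    have "prob {\<omega> \<in> space M. \<bar>a i * X i \<omega> - b * Y \<omega>\<bar> > \<epsilon>} \<le>
      prob {\<omega> \<in> space M. \<bar>X i \<omega> - Y \<omega>\<bar> > \<epsilon>'} + prob {\<omega> \<in> space M. \<bar>Y \<omega>\<bar> > K}"
    proof (rule prob_le_union2)
      have *: "\<bar>a i * x - b * y\<bar> \<le> \<epsilon>" if "\<bar>x - y\<bar> \<le> \<epsilon>'" "\<bar>y\<bar> \<le> K" for x y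
      proof -
        have "a i * x - b * y = a i * (x - y) + (a i - b) * y" by (simp add: algebra_simps)
        then have "\<bar>a i * x - b * y\<bar> \<le> \<bar>a i\<bar> * \<bar>x - y\<bar> + \<bar>a i - b\<bar> * \<bar>y\<bar>"
          by (metis abs_mult abs_triangle_ineq)
        also have "\<dots> \<le> (\<bar>b\<bar> + 1) * \<epsilon>' + \<epsilon> / (2*K) * K"
          using elim that K e by (intro add_mono mult_mono) (auto simp: dist_real_def)
        also have "\<dots> = \<epsilon>"
          using K by (simp add: \<epsilon>'_def field_simps)
        finally show ?thesis .
      qed
      show "{\<omega> \<in> space M. \<bar>a i * X i \<omega> - b * Y \<omega>\<bar> > \<epsilon>} \<subseteq>
        {\<omega> \<in> space M. \<bar>X i \<omega> - Y \<omega>\<bar> > \<epsilon>'} \<union> {\<omega> \<in> space M. \<bar>Y \<omega>\<bar> > K}"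
      proof (rule subsetI, rule ccontr)
        fix \<omega> assume w: "\<omega> \<in> {\<omega> \<in> space M. \<bar>a i * X i \<omega> - b * Y \<omega>\<bar> > \<epsilon>}"
          "\<omega> \<notin> {\<omega> \<in> space M. \<bar>X i \<omega> - Y \<omega>\<bar> > \<epsilon>'} \<union> {\<omega> \<in> space M. \<bar>Y \<omega>\<bar> > K}"
        then have "\<bar>a i * X i \<omega> - b * Y \<omega>\<bar> \<le> \<epsilon>"
          by (intro *) (simp_all add: not_less)
        with w show False by simp
      qed
    qed auto
    with elim K show ?case by linarith
  qed
qed

text \<open>The bounds tend to multiples of \<open>Y\<close> with factors near 1 instead of to
  \<open>Y\<close>. As \<open>Y\<close> may be unbounded, tightness is used first to fix
  \<open>K\<close>, and only then is the tolerance for the factors chosen.\<close>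

lemma tendsto_in_prob_squeeze:
  assumes mX: "\<forall>\<^sub>F i in F. X i \<in> borel_measurable M" and mY: "Y \<in> borel_measurable M"
    and sq: "\<And>e. e > 0 \<Longrightarrow> \<exists>U V \<alpha> \<beta>. \<bar>\<alpha> - 1\<bar> \<le> e \<and> \<bar>\<beta> - 1\<bar> \<le> e
      \<and> tendsto_in_prob M U (\<lambda>\<omega>. \<alpha> * Y \<omega>) F \<and> tendsto_in_prob M V (\<lambda>\<omega>. \<beta> * Y \<omega>) F
      \<and> (\<forall>\<^sub>F i in F. \<forall>\<omega>\<in>space M. U i \<omega> \<le> X i \<omega> \<and> X i \<omega> \<le> V i \<omega>)"
  shows "tendsto_in_prob M X Y F"
proof (rule tendsto_in_probI)
  note [measurable] = mY
  fix \<epsilon> \<delta> :: real assume e: "\<epsilon> > 0" "\<delta> > 0"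
  obtain K where K: "K > 0" "prob {\<omega> \<in> space M. \<bar>Y \<omega>\<bar> > K} < \<delta>/3"
    using prob_abs_tail[OF mY, of "\<delta>/3"] e by auto
  \<comment> \<open>With this tolerance the factor distorts \<open>Y\<close> by at most
    \<open>\<epsilon> / 2\<close> where \<open>\<bar>Y\<bar> \<le> K\<close>. The other half of
    \<open>\<epsilon>\<close> goes to the deviation of \<open>U\<close> or \<open>V\<close>, and
    each of the three bad events gets \<open>\<delta> / 3\<close>.\<close>
  have "\<epsilon> / (2*K) > 0" using e K by simp
  from sq[OF this] obtain U V \<alpha> \<beta> where ab: "\<bar>\<alpha> - 1\<bar> \<le> \<epsilon> / (2*K)" "\<bar>\<beta> - 1\<bar> \<le> \<epsilon> / (2*K)"
      and U: "tendsto_in_prob M U (\<lambda>\<omega>. \<alpha> * Y \<omega>) F" and V: "tendsto_in_prob M V (\<lambda>\<omega>. \<beta> * Y \<omega>) F"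
      and UXV: "\<forall>\<^sub>F i in F. \<forall>\<omega>\<in>space M. U i \<omega> \<le> X i \<omega> \<and> X i \<omega> \<le> V i \<omega>" by blast
  have e': "\<epsilon>/2 > 0" "\<delta>/3 > 0" using e by auto
  have mU: "\<forall>\<^sub>F i in F. U i \<in> borel_measurable M" and mV: "\<forall>\<^sub>F i in F. V i \<in> borel_measurable M"
    using U V by (auto simp: tendsto_in_prob_def)
  from tendsto_in_probD[OF U e'] tendsto_in_probD[OF V e'] mX mU mV UXV
  show "\<forall>\<^sub>F i in F. prob {\<omega> \<in> space M. \<bar>X i \<omega> - Y \<omega>\<bar> > \<epsilon>} < \<delta>"
  proof eventually_elim
    case (elim i)
    note [measurable] = elim(3,4,5)
    let ?U = "{\<omega> \<in> space M. \<bar>U i \<omega> - \<alpha> * Y \<omega>\<bar> > \<epsilon>/2}"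
      and ?V = "{\<omega> \<in> space M. \<bar>V i \<omega> - \<beta> * Y \<omega>\<bar> > \<epsilon>/2}" and ?K = "{\<omega> \<in> space M. \<bar>Y \<omega>\<bar> > K}"
    have *: "\<bar>x - y\<bar> \<le> \<epsilon>" if "\<bar>u - \<alpha> * y\<bar> \<le> \<epsilon>/2" "\<bar>v - \<beta> * y\<bar> \<le> \<epsilon>/2" "\<bar>y\<bar> \<le> K" "u \<le> x" "x \<le> v" for x y u v
    proof -
      have "\<bar>\<gamma> * y - y\<bar> \<le> \<epsilon>/2" if "\<bar>\<gamma> - 1\<bar> \<le> \<epsilon> / (2*K)" for \<gamma>
      proof -
        have "\<bar>\<gamma> * y - y\<bar> = \<bar>\<gamma> - 1\<bar> * \<bar>y\<bar>"
          by (simp add: abs_mult[symmetric] algebra_simps)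
        also have "\<dots> \<le> \<epsilon> / (2*K) * K"
          using that \<open>\<bar>y\<bar> \<le> K\<close> e K by (intro mult_mono) auto
        finally show ?thesis using K by simp
      qed
      from this[OF ab(1)] this[OF ab(2)] that show ?thesis by linarith
    qed
    have "prob {\<omega> \<in> space M. \<bar>X i \<omega> - Y \<omega>\<bar> > \<epsilon>} \<le> prob (?U \<union> ?V) + prob ?K"
    proof (rule prob_le_union2)
      show "{\<omega> \<in> space M. \<bar>X i \<omega> - Y \<omega>\<bar> > \<epsilon>} \<subseteq> ?U \<union> ?V \<union> ?K"
      proof (rule subsetI, rule ccontr)
        fix \<omega> assume w: "\<omega> \<in> {\<omega> \<in> space M. \<bar>X i \<omega> - Y \<omega>\<bar> > \<epsilon>}" "\<omega> \<notin> ?U \<union> ?V \<union> ?K"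
        then have "\<bar>X i \<omega> - Y \<omega>\<bar> \<le> \<epsilon>"
          using elim(6) by (intro *[of "U i \<omega>" "Y \<omega>" "V i \<omega>"]) (auto simp: not_less)
        with w show False by simp
      qed
    qed auto
    moreover have "prob (?U \<union> ?V) \<le> prob ?U + prob ?V"
      by (intro measure_Un_le) auto
    ultimately show ?case using elim(1,2) K by linarith
  qed
qed (use mX mY in auto)

end

section \<open>Measurability of the coefficients and Parseval's identity\<close>

lemma GC_holomorphic: "GC N \<omega> holomorphic_on ball 0 1"
proof (cases "\<forall>w\<in>ball 0 1. summable (\<lambda>k. w ^ Suc k / of_real (sqrt (real (Suc k))) * N (Suc k) \<omega>)")
  case True
  define a where "a n = (if n = 0 then 0 else N n \<omega> / of_real (sqrt (real n)))" for n
  show ?thesis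
  proof (rule power_series_holomorphic[where a = a])
    fix w :: complex assume w: "w \<in> ball 0 1"
    have "(\<lambda>k. w ^ Suc k / of_real (sqrt (real (Suc k))) * N (Suc k) \<omega>) sums GC N \<omega> w"
      using True w by (simp add: GC_def summable_sums)
    then have "(\<lambda>k. a (Suc k) * w ^ Suc k) sums GC N \<omega> w"
      by (simp add: a_def mult_ac)
    then show "(\<lambda>n. a n * (w - 0) ^ n) sums GC N \<omega> w"
      using sums_Suc_iff[of "\<lambda>n. a n * w ^ n" "GC N \<omega> w"] by (simp add: a_def)
  qed
next
  case False
  \<comment> \<open>The convergence condition does not involve \<open>z\<close>, so the default
    value applies at all points at once.\<close>
  then have "GC N \<omega> = (\<lambda>z. 0)" unfolding GC_def fun_eq_iff by (simp only: if_False simp_thms)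
  then show ?thesis by simp
qed

text \<open>A power series converging at a point converges at all points of smaller modulus, so
  radii increasing to 1 suffice. The uncountable condition in \<open>GC\<close> thereby becomes
  countable, hence a measurable event.\<close>

lemma summable_powser_ball_iff:
  fixes a :: "nat \<Rightarrow> complex"
  shows "(\<forall>w\<in>ball 0 1. summable (\<lambda>k. w ^ Suc k * a k)) \<longleftrightarrow>
    (\<forall>m::nat. summable (\<lambda>k. (of_real (real m / real (Suc m))) ^ Suc k * a k))"
proof safe
  fix m :: nat assume "\<forall>w\<in>ball 0 1. summable (\<lambda>k. w ^ Suc k * a k)"
  moreover have "complex_of_real (real m / real (Suc m)) \<in> ball 0 1"
    unfolding mem_ball_0 norm_of_real by simp
  ultimately show "summable (\<lambda>k. (of_real (real m / real (Suc m))) ^ Suc k * a k)" by blast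
next
  fix w :: complex
  assume *: "\<forall>m::nat. summable (\<lambda>k. (of_real (real m / real (Suc m))) ^ Suc k * a k)"
    and w: "w \<in> ball 0 1"
  have "(\<lambda>m. real m / real (Suc m)) \<longlonglongrightarrow> 1" by (rule LIMSEQ_n_over_Suc_n)
  then have "\<forall>\<^sub>F m in sequentially. norm w < real m / real (Suc m)"
    using w by (intro order_tendstoD) auto
  then obtain m :: nat where m: "norm w < real m / real (Suc m)"
    by (auto simp: eventually_sequentially)
  define x where "x = complex_of_real (real m / real (Suc m))"
  have "norm w < norm x" unfolding x_def norm_of_real using m by simp
  then have "x \<noteq> 0" by auto
  have "summable (\<lambda>k. x * (a k * x ^ k))"
    using *[rule_format, of m] unfolding x_def[symmetric] by (simp add: mult_ac)
  then have "summable (\<lambda>k. a k * x ^ k)"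
    using \<open>x \<noteq> 0\<close> by (auto intro: summable_mult_D)
  from summable_mult[OF powser_inside[OF this \<open>norm w < norm x\<close>], of w]
  show "summable (\<lambda>k. w ^ Suc k * a k)" by (simp add: mult_ac)
qed

lemma measurable_GC:
  assumes [measurable]: "\<And>k. k \<ge> 1 \<Longrightarrow> N k \<in> borel_measurable M"
  shows "(\<lambda>\<omega>. GC N \<omega> z) \<in> borel_measurable M"
proof -
  have [measurable]: "N (Suc k) \<in> borel_measurable M" for k by simp
  \<comment> \<open>The Cauchy form mentions only partial sums, so measurability can be read off
    without knowing the limit.\<close>
  have *: "(\<forall>w\<in>ball 0 1. summable (\<lambda>k. w ^ Suc k / of_real (sqrt (real (Suc k))) * N (Suc k) \<omega>)) \<longleftrightarrow>
    (\<forall>m::nat. Cauchy (\<lambda>n. \<Sum>k<n. (of_real (real m / real (Suc m))) ^ Suc k *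
        (N (Suc k) \<omega> / complex_of_real (sqrt (real (Suc k))))))" for \<omega>
    using summable_powser_ball_iff[of "\<lambda>k. N (Suc k) \<omega> / complex_of_real (sqrt (real (Suc k)))"]
    by (simp add: summable_iff_convergent Cauchy_convergent_iff del: power_Suc)
  show ?thesis
    unfolding GC_def * by measurable
qed

text \<open>A derivative is the pointwise limit of difference quotients along one sequence of
  increments common to all \<open>\<omega>\<close>; each quotient is measurable by
  induction.\<close>

lemma measurable_higher_deriv:
  fixes f :: "'a \<Rightarrow> complex \<Rightarrow> complex"
  assumes hol: "\<And>\<omega>. \<omega> \<in> space M \<Longrightarrow> f \<omega> holomorphic_on S" and S: "open S"
    and meas: "\<And>z. z \<in> S \<Longrightarrow> (\<lambda>\<omega>. f \<omega> z) \<in> borel_measurable M"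
  shows "z \<in> S \<Longrightarrow> (\<lambda>\<omega>. (deriv ^^ n) (f \<omega>) z) \<in> borel_measurable M"
proof (induction n arbitrary: z)
  case 0
  then show ?case using meas by simp
next
  case (Suc n)
  let ?g = "\<lambda>\<omega>. (deriv ^^ n) (f \<omega>)"
  obtain e where e: "e > 0" "ball z e \<subseteq> S" using S Suc.prems by (meson openE)
  \<comment> \<open>The shift by 2 keeps the increments nonzero and of modulus strictly below
    \<open>e\<close>.\<close>
  define h where "h m = complex_of_real (e / real (m + 2))" for m
  have h: "z + h m \<in> S" "h m \<noteq> 0" for m
  proof -
    have "e * 1 < e * real (m + 2)" using e by (intro mult_strict_left_mono) auto
    then have "e / real (m + 2) < e" using e by (simp add: divide_less_eq)
    then have "dist z (z + h m) < e" using e by (simp add: h_def dist_norm norm_divide del: of_real_divide)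
    then show "z + h m \<in> S" using e by auto
    show "h m \<noteq> 0" using e by (auto simp: h_def simp flip: of_nat_Suc)
  qed
  have "(\<lambda>m. e / real (m + 2)) \<longlonglongrightarrow> 0" by real_asymp
  from tendsto_of_real[OF this, where 'a = complex] have h0: "h \<longlonglongrightarrow> 0"
    unfolding h_def by (simp only: of_real_0)
  show ?case
  proof (rule borel_measurable_LIMSEQ_metric)
    show "(\<lambda>\<omega>. (?g \<omega> (z + h m) - ?g \<omega> z) / h m) \<in> borel_measurable M" for m
      using Suc.IH[OF Suc.prems] Suc.IH[OF h(1)] by measurable
    fix \<omega> assume "\<omega> \<in> space M"
    then have "?g \<omega> holomorphic_on S"
      by (intro holomorphic_higher_deriv hol S)
    then have "(?g \<omega> has_field_derivative deriv (?g \<omega>) z) (at z)"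
      using Suc.prems S by (simp add: holomorphic_derivI)
    then have "(\<lambda>h. (?g \<omega> (z + h) - ?g \<omega> z) / h) \<midarrow>0\<rightarrow> deriv (?g \<omega>) z"
      by (simp add: DERIV_def)
    moreover have "filterlim h (at 0) sequentially"
      using h h0 by (intro filterlim_atI) auto
    ultimately have "(\<lambda>m. (?g \<omega> (z + h m) - ?g \<omega> z) / h m) \<longlonglongrightarrow> deriv (?g \<omega>) z"
      by (rule filterlim_compose)
    then show "(\<lambda>m. (?g \<omega> (z + h m) - ?g \<omega> z) / h m) \<longlonglongrightarrow> (deriv ^^ Suc n) (f \<omega>) z"
      by simp
  qed
qed

lemma holomorphic_exp_GC: "(\<lambda>z. exp (complex_of_real a * GC N \<omega> z)) holomorphic_on ball 0 1"
  by (intro holomorphic_intros GC_holomorphic)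

lemma measurable_c:
  assumes "\<And>k. k \<ge> 1 \<Longrightarrow> N k \<in> borel_measurable M"
  shows "c N \<theta> n \<in> borel_measurable M"
proof -
  have "(\<lambda>\<omega>. (deriv ^^ n) (\<lambda>z. exp (of_real (sqrt \<theta>) * GC N \<omega> z)) 0) \<in> borel_measurable M"
    using measurable_GC[of N M] assms
    by (intro measurable_higher_deriv[of M _ "ball 0 1"] holomorphic_exp_GC) auto
  then show ?thesis
    by (simp add: c_def[abs_def] fps_expansion_def)
qed

section \<open>Parseval's identity on circles inside the unit disc\<close>

lemma borel_measurable_cis[measurable]: "cis \<in> borel_measurable borel"
  by (intro borel_measurable_continuous_onI continuous_intros)

text \<open>For nonzero \<open>k\<close> the antiderivative \<open>cis (k * t) / (\<i> * k)\<close>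
  takes equal values at 0 and \<open>2 * pi\<close>.\<close>

lemma integral_cis_int:
  fixes k :: int
  shows "(\<integral>t. cis (of_int k * t) \<partial>restrict_space lborel {0..<2*pi}) = (if k = 0 then 2 * pi else 0)"
proof (cases "k = 0")
  case True
  then show ?thesis by (simp add: measure_restrict_space scaleR_conv_of_real)
next
  case False
  have "(\<integral>t. cis (of_int k * t) \<partial>restrict_space lborel {0..<2*pi})
     = (\<integral>t. indicator {0..<2*pi} t *\<^sub>R cis (of_int k * t) \<partial>lborel)"
    by (simp add: integral_restrict_space set_lebesgue_integral_def)
  \<comment> \<open>Adding the endpoint, a null set, gives the closed interval required by the
    fundamental theorem of calculus.\<close>
  also have "\<dots> = (\<integral>t. indicator {0..2*pi} t *\<^sub>R cis (of_int k * t) \<partial>lborel)"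
  proof (rule integral_cong_AE)
    show "AE t in lborel. indicator {0..<2*pi} t *\<^sub>R cis (of_int k * t) = indicator {0..2*pi} t *\<^sub>R cis (of_int k * t)"
      using AE_lborel_singleton[of "2*pi"] by eventually_elim (auto simp: indicator_def)
  qed measurable
  also have "\<dots> = cis (of_int k * (2*pi)) / (\<i> * of_int k) - cis (of_int k * 0) / (\<i> * of_int k)"
  proof (rule integral_FTC_atLeastAtMost)
    fix t :: real
    have ii: "\<i> * (x * (\<i> * y)) = - (x * y)" for x y :: complex
      by (simp add: complex_eq_iff)
    have "((\<lambda>t. cis (of_int k * t) / (\<i> * of_int k)) has_vector_derivative
        (of_int k *\<^sub>R (\<i> * cis (of_int k * t))) / (\<i> * of_int k)) (at t within {0..2*pi})"
      unfolding has_vector_derivative_def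
      by (auto intro!: derivative_eq_intros simp: fun_eq_iff scaleR_conv_of_real divide_simps ii)
    then show "((\<lambda>t. cis (of_int k * t) / (\<i> * of_int k)) has_vector_derivative
        cis (of_int k * t)) (at t within {0..2*pi})"
      using False by (simp add: scaleR_conv_of_real)
  qed (auto intro!: continuous_intros)
  also have "cis (of_int k * (2*pi)) = 1"
    using cis_multiple_2pi[of "of_int k"] by (simp add: mult_ac)
  finally show ?thesis using False by simp
qed

lemma finite_measure_circle: "finite_measure (restrict_space lborel {0..<2*pi})"
  by (rule finite_measureI) (simp add: space_restrict_space emeasure_restrict_space)

text \<open>The squared modulus expands into a double sum with frequencies \<open>n - m\<close>, of
  which orthogonality leaves the diagonal. The computation is done over the complex numbers and
  transferred back by injectivity of \<open>of_real\<close>.\<close>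

lemma integral_norm_sq_trig_poly:
  fixes b :: "nat \<Rightarrow> complex"
  shows "(\<integral>t. (cmod (\<Sum>n<K. b n * cis (real n * t)))\<^sup>2 \<partial>restrict_space lborel {0..<2*pi})
    = (\<Sum>n<K. 2 * pi * (cmod (b n))\<^sup>2)"
proof -
  interpret finite_measure "restrict_space lborel {0..<2*pi}" by (rule finite_measure_circle)
  let ?R = "restrict_space lborel {0..<2*pi}"
  have int: "integrable ?R (\<lambda>t. x * cis (of_int k * t))" for k :: int and x :: complex
    by (rule integrable_const_bound[where B = "cmod x"])
       (auto intro!: measurable_restrict_space1 simp: norm_mult)
  have "complex_of_real (\<integral>t. (cmod (\<Sum>n<K. b n * cis (real n * t)))\<^sup>2 \<partial>?R)
    = (\<integral>t. (\<Sum>n<K. \<Sum>m<K. (b n * cnj (b m)) * cis (of_int (int n - int m) * t)) \<partial>?R)"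
    unfolding integral_complex_of_real[symmetric]
  proof (rule Bochner_Integration.integral_cong[OF refl])
    fix t :: real
    have "complex_of_real ((cmod (\<Sum>n<K. b n * cis (real n * t)))\<^sup>2)
        = (\<Sum>n<K. b n * cis (real n * t)) * (\<Sum>m<K. cnj (b m) * cis (- (real m * t)))"
      by (simp only: complex_norm_square cnj_sum complex_cnj_mult cis_cnj)
    also have "\<dots> = (\<Sum>n<K. \<Sum>m<K. (b n * cnj (b m)) * (cis (real n * t) * cis (- (real m * t))))"
      by (simp add: sum_product mult_ac)
    also have "\<dots> = (\<Sum>n<K. \<Sum>m<K. (b n * cnj (b m)) * cis (of_int (int n - int m) * t))"
      by (simp add: cis_mult left_diff_distrib)
    finally show "complex_of_real ((cmod (\<Sum>n<K. b n * cis (real n * t)))\<^sup>2)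
       = (\<Sum>n<K. \<Sum>m<K. (b n * cnj (b m)) * cis (of_int (int n - int m) * t))" .
  qed
  also have "\<dots> = (\<Sum>n<K. \<Sum>m<K. (b n * cnj (b m)) * (if int n - int m = 0 then 2 * pi else 0))"
    using int by (simp only: integral_cis_int integral_mult_right_zero
        Bochner_Integration.integral_sum Bochner_Integration.integrable_sum)
  also have "\<dots> = (\<Sum>n<K. of_real (2 * pi * (cmod (b n))\<^sup>2))"
    by (intro sum.cong refl) (simp add: if_distrib sum.delta' complex_norm_square[symmetric] mult_ac cong: if_cong)
  finally show ?thesis by (simp only: of_real_sum[symmetric] of_real_eq_iff)
qed

text \<open>The Taylor polynomials converge pointwise on the circle of radius \<open>r\<close> and
  are bounded there by the absolutely convergent sum \<open>S\<close>. Dominated convergence carries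
  the identity for trigonometric polynomials to the limit.\<close>

lemma Parseval_ball:
  assumes f: "f holomorphic_on ball 0 1" and r: "0 \<le> r" "r < 1"
  shows "(\<lambda>n. 2 * pi * ((cmod (fps_nth (fps_expansion f 0) n))\<^sup>2 * r ^ (2 * n))) sums
    (\<integral>t. (cmod (f (of_real r * cis t)))\<^sup>2 \<partial>restrict_space lborel {0..<2*pi})"
proof -
  interpret finite_measure "restrict_space lborel {0..<2*pi}" by (rule finite_measure_circle)
  let ?R = "restrict_space lborel {0..<2*pi}"
  define a where "a = fps_nth (fps_expansion f 0)"
  have a: "(\<lambda>n. a n * w ^ n) sums f w" if "cmod w < 1" for w
    using holomorphic_power_series[OF f, of w] that by (simp add: a_def fps_expansion_def)
  define b where "b n = a n * of_real r ^ n" for n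
  \<comment> \<open>Convergence at the intermediate radius \<open>s\<close> forces absolute
    convergence at \<open>r\<close>.\<close>
  obtain s where s: "r < s" "s < 1" using r dense by blast
  have "summable (\<lambda>n. a n * (of_real s) ^ n)"
    using a[of "of_real s"] r s by (auto simp: sums_iff)
  then have sb: "summable (\<lambda>n. cmod (b n))"
    unfolding b_def by (rule powser_insidea) (use r s in auto)
  define S where "S = (\<Sum>n. cmod (b n))"
  let ?P = "\<lambda>K t. \<Sum>n<K. b n * cis (real n * t)"
  have P: "(\<lambda>K. ?P K t) \<longlonglongrightarrow> f (of_real r * cis t)" for t
    using a[of "of_real r * cis t"] r
    by (simp add: sums_def b_def norm_mult power_mult_distrib Complex.DeMoivre mult_ac)
  have mP: "?P K \<in> borel_measurable ?R" for K
    by (intro measurable_restrict_space1) measurable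
  have Pb: "cmod (?P K t) \<le> S" for K t
  proof -
    have "cmod (?P K t) \<le> (\<Sum>n<K. cmod (b n))"
      by (rule order_trans[OF norm_sum]) (simp add: norm_mult)
    also have "\<dots> \<le> S" unfolding S_def by (intro sum_le_suminf sb) auto
    finally show ?thesis .
  qed
  have "(\<lambda>K. \<integral>t. (cmod (?P K t))\<^sup>2 \<partial>?R) \<longlonglongrightarrow> (\<integral>t. (cmod (f (of_real r * cis t)))\<^sup>2 \<partial>?R)"
  proof (rule integral_dominated_convergence[where w = "\<lambda>_. S\<^sup>2"])
    have "(\<lambda>t. f (of_real r * cis t)) \<in> borel_measurable ?R"
      by (rule borel_measurable_LIMSEQ_metric[OF mP P])
    then show "(\<lambda>t. (cmod (f (of_real r * cis t)))\<^sup>2) \<in> borel_measurable ?R" by measurable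
    show "(\<lambda>t. (cmod (?P K t))\<^sup>2) \<in> borel_measurable ?R" for K
      using mP by measurable
    show "AE t in ?R. (\<lambda>K. (cmod (?P K t))\<^sup>2) \<longlonglongrightarrow> (cmod (f (of_real r * cis t)))\<^sup>2"
      by (intro AE_I2 tendsto_intros P)
    show "AE t in ?R. norm ((cmod (?P K t))\<^sup>2) \<le> S\<^sup>2" for K
      using Pb by (auto intro!: power_mono)
  qed simp
  then have "(\<lambda>n. 2 * pi * (cmod (b n))\<^sup>2) sums (\<integral>t. (cmod (f (of_real r * cis t)))\<^sup>2 \<partial>?R)"
    by (simp only: sums_def integral_norm_sq_trig_poly)
  then show ?thesis
    using r by (simp add: b_def a_def norm_mult norm_power power_mult_distrib power_mult[symmetric] mult_ac)
qed

text \<open>Since \<open>G\<close> is twice the real part of \<open>GC\<close>, the density is a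
  constant times the squared modulus of \<open>exp (sqrt \<theta> * GC)\<close>, whose Taylor
  coefficients are the \<open>c N \<theta> q\<close>. Parseval then evaluates the total
  mass.\<close>

lemma gmc_approx_mass_sums:
  assumes r: "0 < r" "r < 1" and \<theta>: "0 \<le> \<theta>"
  shows "(\<lambda>q. (cmod (c N \<theta> q \<omega>))\<^sup>2 * r ^ (2 * q)) sums
     ((\<integral>t. 1 \<partial>gmc_approx N \<theta> r \<omega>) / (2 * pi) /
      ((if \<theta> = 1 then sqrt (ln (1 / (1 - r\<^sup>2))) else 1) * (1 - r\<^sup>2) powr \<theta>))"
proof -
  let ?R = "restrict_space lborel {0..<2*pi}"
  define L where "L = (if \<theta> = 1 then sqrt (ln (1 / (1 - r\<^sup>2))) else 1) * (1 - r\<^sup>2) powr \<theta>"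
  have r2: "0 < r\<^sup>2" "r\<^sup>2 < 1" using r by (auto simp: power_less_one_iff abs_square_less_1)
  \<comment> \<open>Positivity of \<open>r\<close> keeps the logarithm away from 0, so the
    normalisation \<open>L\<close> can be divided out.\<close>
  then have "ln (1 / (1 - r\<^sup>2)) > 0" by (intro ln_gt_zero) (simp add: field_simps)
  then have L: "L > 0" using r2 by (simp add: L_def)
  define f where "f = (\<lambda>z. exp (of_real (sqrt \<theta>) * GC N \<omega> z))"
  have f: "f holomorphic_on ball 0 1" unfolding f_def by (rule holomorphic_exp_GC)
  have fG: "exp (sqrt \<theta> * G N \<omega> z) = (cmod (f z))\<^sup>2" for z
    by (simp add: f_def G_def norm_exp_eq_Re power2_eq_square flip: exp_add)
  have "continuous_on (ball 0 1) f" by (intro holomorphic_on_imp_continuous_on f)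
  then have "continuous_on UNIV (\<lambda>t. f (of_real r * cis t))"
    by (rule continuous_on_compose2) (use r in \<open>auto intro!: continuous_intros simp: norm_mult\<close>)
  then have [measurable]: "(\<lambda>t. f (of_real r * cis t)) \<in> borel_measurable borel"
    by (rule borel_measurable_continuous_onI)
  have "(\<integral>t. 1 \<partial>gmc_approx N \<theta> r \<omega>) = (\<integral>t. L * (cmod (f (of_real r * cis t)))\<^sup>2 *\<^sub>R 1 \<partial>?R)"
    unfolding gmc_approx_def fG L_def[symmetric] using L
    by (subst integral_density) (auto intro!: measurable_restrict_space1)
  also have "\<dots> = L * (\<integral>t. (cmod (f (of_real r * cis t)))\<^sup>2 \<partial>?R)" by simp
  finally have *: "(\<integral>t. (cmod (f (of_real r * cis t)))\<^sup>2 \<partial>?R) = (\<integral>t. 1 \<partial>gmc_approx N \<theta> r \<omega>) / L"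
    using L by (simp add: field_simps)
  have "(\<lambda>q. 2 * pi * ((cmod (c N \<theta> q \<omega>))\<^sup>2 * r ^ (2 * q))) sums ((\<integral>t. 1 \<partial>gmc_approx N \<theta> r \<omega>) / L)"
    using Parseval_ball[OF f, of r] r by (simp add: c_def f_def[symmetric] *)
  from sums_divide[OF this, of "2 * pi"] show ?thesis
    unfolding L_def[symmetric] by (simp add: mult_ac)
qed

section \<open>Polynomial sandwich for the cutoff\<close>

text \<open>The unnormalised Gamma distribution. Up to a factor it is the limit object in Karamata's
  argument: the weights \<open>\<bar>c\<^sub>q\<bar>\<^sup>2 * exp (- q / n)\<close> at the points
  \<open>q / n\<close>, suitably normalised, behave like it.\<close>

definition gamma_measure :: "real \<Rightarrow> real measure" where
  "gamma_measure \<theta> = density lborel (\<lambda>x. ennreal (indicator {0..} x * x powr (\<theta> - 1) / exp x))"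

lemma sets_gamma_measure[measurable_cong]: "sets (gamma_measure \<theta>) = sets borel"
  and space_gamma_measure[simp]: "space (gamma_measure \<theta>) = UNIV"
  by (simp_all add: gamma_measure_def)

lemma emeasure_gamma_measure:
  assumes "\<theta> > 0"
  shows "emeasure (gamma_measure \<theta>) UNIV = ennreal (Gamma \<theta>)"
  unfolding gamma_measure_def Gamma_conv_nn_integral_real[OF assms]
  by (subst emeasure_density) auto

text \<open>Nonnegativity places \<open>exp (- x)\<close> in the unit interval; the excluded point
  \<open>a\<close> absorbs the jump of \<open>trunc_inverse\<close>.\<close>

lemma AE_gamma_measure:
  "AE x in gamma_measure \<theta>. x \<ge> 0 \<and> x \<noteq> a"
  unfolding gamma_measure_def
  by (subst AE_density, measurable, use AE_lborel_singleton[of a] in eventually_elim)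
     (auto simp: indicator_def)

text \<open>Substitute \<open>(i + 1) * x\<close> in the Gamma integral. The exponential in the
  density raises the exponent from \<open>i\<close> to \<open>i + 1\<close>, which matches the
  Laplace parameter \<open>j = Suc i\<close>.\<close>

lemma moment_gamma_measure:
  assumes \<theta>: "\<theta> > 0"
  shows "has_bochner_integral (gamma_measure \<theta>) (\<lambda>x. exp (- x) ^ i) (Gamma \<theta> * real (Suc i) powr (- \<theta>))"
proof (rule has_bochner_integral_nn_integral)
  have Gpos: "Gamma \<theta> > 0" using \<theta> by (rule Gamma_real_pos)
  let ?j = "real (Suc i)"
  let ?w = "\<lambda>x::real. indicator {0..} x * x powr (\<theta> - 1) / exp x"
  show "0 \<le> Gamma \<theta> * ?j powr (- \<theta>)" using Gpos by simp
  show "(\<integral>\<^sup>+ x. ennreal (exp (- x) ^ i) \<partial>gamma_measure \<theta>) = ennreal (Gamma \<theta> * ?j powr (- \<theta>))"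
  proof -
    have "ennreal (Gamma \<theta>) = (\<integral>\<^sup>+ x. ennreal (?w x) \<partial>lborel)"
      by (rule Gamma_conv_nn_integral_real[OF \<theta>])
    also have "\<dots> = ennreal ?j * (\<integral>\<^sup>+ x. ennreal (?w (?j * x)) \<partial>lborel)"
      by (subst nn_integral_real_affine[where c = ?j and t = 0]) auto
    also have "(\<lambda>x. ennreal (?w (?j * x))) =
        (\<lambda>x. ennreal (?j powr (\<theta> - 1)) * (ennreal (?w x) * ennreal (exp (- x) ^ i)))"
    proof (rule ext)
      fix x :: real
      have "?w (?j * x) = ?j powr (\<theta> - 1) * (?w x * exp (- x) ^ i)"
      proof (cases "x \<ge> 0")
        case True
        have "exp (?j * x) = exp x * exp (real i * x)"
          by (simp add: exp_add[symmetric] algebra_simps)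
        moreover have "exp (- x) ^ i = inverse (exp (real i * x))"
          by (simp add: exp_of_nat_mult[symmetric] exp_minus[symmetric])
        ultimately show ?thesis using True
          by (simp add: powr_mult field_simps del: of_nat_Suc)
      next
        case False
        then have "\<not> 0 \<le> ?j * x" by (simp add: zero_le_mult_iff)
        with False show ?thesis by simp
      qed
      then show "ennreal (?w (?j * x)) = ennreal (?j powr (\<theta> - 1)) * (ennreal (?w x) * ennreal (exp (- x) ^ i))"
        by (simp add: ennreal_mult' ennreal_mult''[symmetric] del: of_nat_Suc)
    qed
    also have "ennreal ?j * (\<integral>\<^sup>+ x. ennreal (?j powr (\<theta> - 1)) * (ennreal (?w x) * ennreal (exp (- x) ^ i)) \<partial>lborel)
       = ennreal (?j powr \<theta>) * (\<integral>\<^sup>+ x. ennreal (exp (- x) ^ i) \<partial>gamma_measure \<theta>)"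
      unfolding gamma_measure_def
      by (subst nn_integral_density, measurable, subst nn_integral_cmult, measurable)
         (simp add: mult.assoc[symmetric] ennreal_mult''[symmetric] powr_diff del: of_nat_Suc)
    finally have *: "ennreal (Gamma \<theta>) = ennreal (?j powr \<theta>) * (\<integral>\<^sup>+ x. ennreal (exp (- x) ^ i) \<partial>gamma_measure \<theta>)" .
    \<comment> \<open>Multiplying by the inverse power isolates the integral without a division in
      \<open>ennreal\<close>.\<close>
    have "ennreal (Gamma \<theta> * ?j powr (- \<theta>)) = ennreal (?j powr (-\<theta>)) * ennreal (Gamma \<theta>)"
      by (simp add: ennreal_mult''[symmetric] mult.commute)
    also have "\<dots> = ennreal (?j powr (-\<theta>) * ?j powr \<theta>) * (\<integral>\<^sup>+ x. ennreal (exp (- x) ^ i) \<partial>gamma_measure \<theta>)"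
      unfolding * by (simp add: mult.assoc[symmetric] ennreal_mult''[symmetric])
    also have "?j powr (-\<theta>) * ?j powr \<theta> = 1"
      by (simp add: powr_add[symmetric])
    finally show ?thesis by simp
  qed
qed auto

text \<open>Chosen so that \<open>x * trunc_inverse x\<close> at \<open>x = exp (- q / n)\<close> is the indicator of \<open>q \<le> n\<close>.\<close>

definition trunc_inverse :: "real \<Rightarrow> real" where
  "trunc_inverse x = (if exp (- 1) \<le> x then 1 / x else 0)"

lemma borel_measurable_trunc_inverse[measurable]: "trunc_inverse \<in> borel_measurable borel"
  unfolding trunc_inverse_def[abs_def] by measurable

text \<open>For \<open>x\<close> in the unit interval \<open>trunc_inverse (exp (- x))\<close> is
  \<open>exp x\<close>, which cancels the exponential of the density; for larger \<open>x\<close> it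
  is 0. What remains is the integral of \<open>x powr (\<theta> - 1)\<close> from 0 to 1, finite
  because \<open>\<theta> - 1 > - 1\<close>.\<close>

lemma integral_trunc_inverse:
  assumes \<theta>: "\<theta> > 0"
  shows "(\<integral>x. trunc_inverse (exp (- x)) \<partial>gamma_measure \<theta>) = 1 / \<theta>"
proof -
  have "(\<integral>x. trunc_inverse (exp (- x)) \<partial>gamma_measure \<theta>)
      = (\<integral>x. (indicator {0..} x * x powr (\<theta> - 1) / exp x) * trunc_inverse (exp (- x)) \<partial>lborel)"
    unfolding gamma_measure_def by (subst integral_density) auto
  also have "\<dots> = (\<integral>x. indicator {0..1} x *\<^sub>R x powr (\<theta> - 1) \<partial>lborel)"
    by (intro Bochner_Integration.integral_cong refl)
       (auto simp: trunc_inverse_def indicator_def exp_minus field_simps)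
  also have "\<dots> = 1 / \<theta>"
  proof -
    have "((\<lambda>x. x powr (\<theta> - 1)) has_integral (1 powr \<theta> / \<theta>)) {0..1}"
      using has_integral_powr_from_0[of "\<theta> - 1" 1] \<theta> by simp
    then have hi: "((\<lambda>x. x powr (\<theta> - 1)) has_integral (1 / \<theta>)) {0..1}" by simp
    have "has_bochner_integral lborel (\<lambda>x::real. indicator {0..1} x * x powr (\<theta> - 1)) (1 / \<theta>)"
      using nn_integral_has_integral_lebesgue[OF _ hi] \<theta>
      by (intro has_bochner_integral_nn_integral) auto
    then show ?thesis by (simp add: has_bochner_integral_integral_eq)
  qed
  finally show ?thesis .
qed

lemma finite_measure_gamma_measure:
  assumes "\<theta> > 0" shows "finite_measure (gamma_measure \<theta>)"
  by (rule finite_measureI) (simp add: emeasure_gamma_measure[OF assms])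

lemma integrable_gamma_measure_bounded:
  assumes "\<theta> > 0" and [measurable]: "f \<in> borel_measurable borel"
    and "\<And>x. x \<in> {0..1} \<Longrightarrow> \<bar>f x\<bar> \<le> (B::real)"
  shows "integrable (gamma_measure \<theta>) (\<lambda>x. f (exp (- x)))"
proof -
  interpret finite_measure "gamma_measure \<theta>" by (rule finite_measure_gamma_measure[OF assms(1)])
  show ?thesis
  proof (rule integrable_const_bound[where B = B])
    show "AE x in gamma_measure \<theta>. norm (f (exp (- x))) \<le> B"
      using AE_gamma_measure[of 0 \<theta>] by eventually_elim (auto intro!: assms(3))
  qed measurable
qed

text \<open>Approximating \<open>h + \<eta> / 2\<close> within \<open>\<eta> / 2\<close> puts the
  polynomial between \<open>h\<close> and \<open>h + \<eta>\<close>.\<close>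

lemma one_sided_Weierstrass:
  fixes h :: "real \<Rightarrow> real"
  assumes "continuous_on {0..1} h" "\<eta> > 0"
  obtains a :: "nat \<Rightarrow> real" and d where
    "\<And>x. x \<in> {0..1} \<Longrightarrow> h x \<le> (\<Sum>i\<le>d. a i * x ^ i) \<and> (\<Sum>i\<le>d. a i * x ^ i) \<le> h x + \<eta>"
proof -
  have "continuous_on {0..1} (\<lambda>x. h x + \<eta>/2)" by (intro continuous_intros assms)
  with assms(2) obtain p where p: "real_polynomial_function p" "\<And>x. x \<in> {0..1} \<Longrightarrow> \<bar>(h x + \<eta>/2) - p x\<bar> < \<eta>/2"
    using Stone_Weierstrass_real_polynomial_function[of "{0..1}" "\<lambda>x. h x + \<eta>/2" "\<eta>/2"] by auto
  from p(1) obtain a d where "p = (\<lambda>x. \<Sum>i\<le>d. a i * x ^ i)"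
    by (auto simp: real_polynomial_function_iff_sum)
  with p(2) show ?thesis by (intro that[of a d]) (smt (verit) field_sum_of_halves)
qed

text \<open>Two approximations from above: \<open>g\<close> by a continuous \<open>h m\<close>,
  close in integral by dominated convergence because the exceptional point is null, and then
  \<open>h m\<close> by a polynomial. Minorants come from applying this to
  \<open>- g\<close>.\<close>

lemma polynomial_majorant:
  fixes g :: "real \<Rightarrow> real" and h :: "nat \<Rightarrow> real \<Rightarrow> real"
  assumes \<theta>: "\<theta> > 0" and e: "e > 0"
    and cont: "\<And>m. continuous_on UNIV (h m)" and [measurable]: "g \<in> borel_measurable borel"
    and bound: "\<And>m x. x \<in> {0..1} \<Longrightarrow> \<bar>h m x\<bar> \<le> B"
    and ge: "\<And>m x. x \<in> {0..1} \<Longrightarrow> g x \<le> h m x"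
    and lim: "\<And>x. x \<in> {0..1} \<Longrightarrow> x \<noteq> exp (- b) \<Longrightarrow> (\<lambda>m. h m x) \<longlonglongrightarrow> g x"
  obtains a :: "nat \<Rightarrow> real" and d where
    "\<And>x. x \<in> {0..1} \<Longrightarrow> g x \<le> (\<Sum>i\<le>d. a i * x ^ i)"
    "\<bar>(\<integral>x. (\<Sum>i\<le>d. a i * exp (- x) ^ i) \<partial>gamma_measure \<theta>) - (\<integral>x. g (exp (- x)) \<partial>gamma_measure \<theta>)\<bar> \<le> e"
proof -
  interpret finite_measure "gamma_measure \<theta>" by (rule finite_measure_gamma_measure[OF \<theta>])
  let ?I = "\<lambda>f. \<integral>x. f (exp (- x)) \<partial>gamma_measure \<theta>"
  have [measurable]: "h m \<in> borel_measurable borel" for m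
    using cont by (rule borel_measurable_continuous_onI)
  have Gpos: "Gamma \<theta> > 0" using \<theta> by (rule Gamma_real_pos)
  have "(\<lambda>m. ?I (h m)) \<longlonglongrightarrow> ?I g"
  proof (rule integral_dominated_convergence[where w = "\<lambda>_. B"])
    show "AE x in gamma_measure \<theta>. (\<lambda>m. h m (exp (- x))) \<longlonglongrightarrow> g (exp (- x))"
      using AE_gamma_measure[of b \<theta>] by eventually_elim (auto intro!: lim)
    show "AE x in gamma_measure \<theta>. norm (h m (exp (- x))) \<le> B" for m
      using AE_gamma_measure[of 0 \<theta>] by eventually_elim (auto intro!: bound)
  qed auto
  then have "\<forall>\<^sub>F m in sequentially. dist (?I (h m)) (?I g) < e/2"
    using e by (intro tendstoD) auto
  then obtain m where m: "\<bar>?I (h m) - ?I g\<bar> < e/2"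
    by (auto simp: eventually_sequentially dist_real_def)
  \<comment> \<open>The constant \<open>\<eta>\<close> integrated against total mass
    \<open>Gamma \<theta>\<close> costs exactly \<open>e / 2\<close>.\<close>
  define \<eta> where "\<eta> = e / (2 * Gamma \<theta>)"
  have "\<eta> > 0" using e Gpos by (simp add: \<eta>_def)
  have "continuous_on {0..1} (h m)" using cont continuous_on_subset by blast
  from one_sided_Weierstrass[OF this \<open>\<eta> > 0\<close>] obtain a d where
    ad: "\<And>x. x \<in> {0..1} \<Longrightarrow> h m x \<le> (\<Sum>i\<le>d. a i * x ^ i) \<and> (\<Sum>i\<le>d. a i * x ^ i) \<le> h m x + \<eta>" by blast
  let ?p = "\<lambda>x. \<Sum>i\<le>d. a i * x ^ i"
  have ih: "integrable (gamma_measure \<theta>) (\<lambda>x. h m (exp (- x)))"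
    by (rule integrable_gamma_measure_bounded[OF \<theta> _ bound]) auto
  have ip: "integrable (gamma_measure \<theta>) (\<lambda>x. ?p (exp (- x)))"
    using has_bochner_integral_iff moment_gamma_measure[OF \<theta>]
    by (intro Bochner_Integration.integrable_sum integrable_mult_right) blast
  have AE: "AE x in gamma_measure \<theta>. h m (exp (- x)) \<le> ?p (exp (- x)) \<and> ?p (exp (- x)) \<le> h m (exp (- x)) + \<eta>"
    using AE_gamma_measure[of 0 \<theta>] by eventually_elim (auto intro!: ad[THEN conjunct1] ad[THEN conjunct2])
  have mass: "measure (gamma_measure \<theta>) UNIV = Gamma \<theta>"
    using Gpos by (simp add: measure_def emeasure_gamma_measure[OF \<theta>])
  have "?I (h m) \<le> ?I ?p"
    by (rule integral_mono_AE[OF ih ip]) (use AE in eventually_elim, auto)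
  moreover have "?I ?p \<le> (\<integral>x. h m (exp (- x)) + \<eta> \<partial>gamma_measure \<theta>)"
    by (rule integral_mono_AE[OF ip]) (use ih in simp, use AE in eventually_elim, auto)
  moreover have "(\<integral>x. h m (exp (- x)) + \<eta> \<partial>gamma_measure \<theta>) = ?I (h m) + e/2"
    using ih Gpos by (simp add: mass \<eta>_def)
  ultimately have "\<bar>?I ?p - ?I g\<bar> \<le> e" using m by linarith
  moreover have "g x \<le> ?p x" if "x \<in> {0..1}" for x
    using ge[OF that, of m] ad[OF that] by linarith
  ultimately show ?thesis by (intro that) auto
qed

text \<open>The jump at \<open>exp (- 1)\<close> is smoothed by steep ramps on either side of it,
  which yields continuous majorants and minorants for \<open>polynomial_majorant\<close>.\<close>

lemma polynomial_sandwich_trunc_inverse: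
  assumes \<theta>: "\<theta> > 0" and e: "e > 0"
  obtains a b :: "nat \<Rightarrow> real" and d d' where
    "\<And>x. x \<in> {0..1} \<Longrightarrow> (\<Sum>i\<le>d. a i * x ^ i) \<le> trunc_inverse x"
    "\<And>x. x \<in> {0..1} \<Longrightarrow> trunc_inverse x \<le> (\<Sum>i\<le>d'. b i * x ^ i)"
    "\<bar>(\<integral>x. (\<Sum>i\<le>d. a i * exp (- x) ^ i) \<partial>gamma_measure \<theta>) - 1 / \<theta>\<bar> \<le> e"
    "\<bar>(\<integral>x. (\<Sum>i\<le>d'. b i * exp (- x) ^ i) \<partial>gamma_measure \<theta>) - 1 / \<theta>\<bar> \<le> e"
proof -
  define s :: real where "s = exp (- 1)"
  have s: "s > 0" by (simp add: s_def)
  \<comment> \<open>For positive \<open>m\<close>, \<open>t = 1\<close> ends the rise at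
    \<open>s\<close> and gives majorants, while \<open>t = 0\<close> starts it at \<open>s\<close>
    and gives minorants.\<close>
  define ramp :: "real \<Rightarrow> nat \<Rightarrow> real \<Rightarrow> real" where
    "ramp t m x = max 0 (min 1 (t + real m * (x - s)))" for t m x
  have r01: "0 \<le> ramp t m x" "ramp t m x \<le> 1" for t m x by (auto simp: ramp_def)
  \<comment> \<open>Dividing by \<open>max x s\<close> agrees with dividing by \<open>x\<close> to
    the right of the jump and avoids the pole at 0.\<close>
  have cont: "continuous_on UNIV (\<lambda>x. ramp t m x / max x s)" for t m
    using s unfolding ramp_def by (intro continuous_intros) (auto simp: max_def)
  have bd: "\<bar>ramp t m x / max x s\<bar> \<le> 1 / s" for t m x
  proof -
    have "\<bar>ramp t m x / max x s\<bar> = ramp t m x / max x s"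
      using r01 s by (simp add: abs_of_nonneg)
    also have "\<dots> \<le> 1 / s" using r01 s by (intro frac_le) auto
    finally show ?thesis .
  qed
  have "filterlim (\<lambda>m. t + real m * y) at_top sequentially" if "y > 0" for t y
    using that by real_asymp
  then have up: "\<forall>\<^sub>F m in sequentially. 1 \<le> t + real m * y" if "y > 0" for t y
    using that unfolding filterlim_at_top by blast
  have lim: "(\<lambda>m. ramp t m x / max x s) \<longlonglongrightarrow> trunc_inverse x" if "x \<noteq> exp (- 1)" for t x
  proof (rule tendsto_eventually)
    show "\<forall>\<^sub>F m in sequentially. ramp t m x / max x s = trunc_inverse x"
    proof (cases "x > s")
      case True
      then show ?thesis using up[of "x - s" t] s
        by (auto elim!: eventually_mono simp: ramp_def trunc_inverse_def s_def[symmetric])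
    next
      case False
      then have "x < s" using that by (simp add: s_def)
      \<comment> \<open>The ramp is 0 once \<open>t + m * (x - s) \<le> 0\<close>, that is, once
        \<open>1 \<le> (1 - t) + m * (s - x)\<close>.\<close>
      then show ?thesis using up[of "s - x" "1 - t"]
        by (auto elim!: eventually_mono simp: ramp_def trunc_inverse_def s_def[symmetric] algebra_simps)
    qed
  qed
  have ge: "trunc_inverse x \<le> ramp 1 m x / max x s" for m x
    using s r01[of 1 m x] by (auto simp: ramp_def trunc_inverse_def s_def[symmetric])
  have le: "- trunc_inverse x \<le> - (ramp 0 m x / max x s)" for m x
  proof (cases "x \<ge> s")
    case True
    then show ?thesis using s r01[of 0 m x] by (simp add: trunc_inverse_def s_def[symmetric] divide_right_mono)
  next
    case False
    then have "real m * (x - s) \<le> 0" by (simp add: mult_nonneg_nonpos)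
    then show ?thesis using False by (simp add: trunc_inverse_def s_def[symmetric] ramp_def)
  qed
  obtain b d' where b: "\<And>x. x \<in> {0..1} \<Longrightarrow> trunc_inverse x \<le> (\<Sum>i\<le>d'. b i * x ^ i)"
    "\<bar>(\<integral>x. (\<Sum>i\<le>d'. b i * exp (- x) ^ i) \<partial>gamma_measure \<theta>) - (\<integral>x. trunc_inverse (exp (- x)) \<partial>gamma_measure \<theta>)\<bar> \<le> e"
    by (rule polynomial_majorant[OF \<theta> e cont borel_measurable_trunc_inverse bd ge lim[of _ 1]]) blast+
  \<comment> \<open>A majorant of the negated function; negating its coefficients below gives the
    minorant.\<close>
  obtain a d where a: "\<And>x. x \<in> {0..1} \<Longrightarrow> - trunc_inverse x \<le> (\<Sum>i\<le>d. a i * x ^ i)"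
    "\<bar>(\<integral>x. (\<Sum>i\<le>d. a i * exp (- x) ^ i) \<partial>gamma_measure \<theta>) - (\<integral>x. - trunc_inverse (exp (- x)) \<partial>gamma_measure \<theta>)\<bar> \<le> e"
    by (rule polynomial_majorant[OF \<theta> e, of "\<lambda>m x. - (ramp 0 m x / max x s)" "\<lambda>x. - trunc_inverse x" "1/s" 1])
       (use cont bd le lim[of _ 0] in \<open>auto intro!: continuous_on_minus tendsto_minus simp del: abs_divide\<close>)
  show ?thesis
  proof (rule that[where a = "\<lambda>i. - a i" and b = b])
    show "(\<Sum>i\<le>d. - a i * x ^ i) \<le> trunc_inverse x" if "x \<in> {0..1}" for x
      using a(1)[OF that] by (simp add: sum_negf)
    show "\<bar>(\<integral>x. (\<Sum>i\<le>d. - a i * exp (- x) ^ i) \<partial>gamma_measure \<theta>) - 1 / \<theta>\<bar> \<le> e"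
      using a(2) by (simp add: sum_negf integral_trunc_inverse[OF \<theta>])
  qed (use b integral_trunc_inverse[OF \<theta>] in auto)
qed

section \<open>The Tauberian argument\<close>

text \<open>With \<open>y = n\<close> and \<open>y = 1 / (1 - r\<^sup>2)\<close> this is the correction factor of \<^const>\<open>approx_mass\<close>
  and of \<^const>\<open>gmc_approx\<close>, respectively.\<close>

definition log_corr :: "real \<Rightarrow> real \<Rightarrow> real" where
  "log_corr \<theta> y = (if \<theta> = 1 then sqrt (ln y) else 1)"

text \<open>At \<open>r = exp (- j / (2 * n))\<close> one has
  \<open>1 - r\<^sup>2 = 1 - exp (- j / n)\<close>, asymptotic to \<open>j / n\<close>. The powers
  thus contribute \<open>j powr (- \<theta>)\<close>, and for \<open>\<theta> = 1\<close> the ratio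
  of the two logarithms tends to 1.\<close>

lemma normalisation_ratio_tendsto:
  assumes j: "j > (0::real)"
  shows "(\<lambda>n. (log_corr \<theta> (real n) / real n powr \<theta>) /
      (log_corr \<theta> (1 / (1 - (exp (- j / (2 * real n)))\<^sup>2)) * (1 - (exp (- j / (2 * real n)))\<^sup>2) powr \<theta>))
    \<longlonglongrightarrow> j powr (- \<theta>)"
proof (cases "\<theta> = 1")
  case True
  have "(\<lambda>n. (sqrt (ln (real n)) / real n powr 1) /
      (sqrt (ln (1 / (1 - (exp (- j / (2 * real n)))\<^sup>2))) * (1 - (exp (- j / (2 * real n)))\<^sup>2) powr 1))
    \<longlonglongrightarrow> j powr (- 1)"
    using j by (real_asymp simp: powr_minus)
  then show ?thesis by (simp add: log_corr_def True)
next
  case False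
  have "(\<lambda>n. real n * (1 - (exp (- j / (2 * real n)))\<^sup>2)) \<longlonglongrightarrow> j"
    using j by real_asymp
  then have "(\<lambda>n. (real n * (1 - (exp (- j / (2 * real n)))\<^sup>2)) powr (- \<theta>)) \<longlonglongrightarrow> j powr (- \<theta>)"
    using j by (intro tendsto_powr tendsto_const) auto
  moreover have "(real n * (1 - (exp (- j / (2 * real n)))\<^sup>2)) powr (- \<theta>) =
      1 / real n powr \<theta> / (1 - (exp (- j / (2 * real n)))\<^sup>2) powr \<theta>" for n
    using j by (simp add: powr_mult powr_minus divide_simps power_le_one)
  ultimately show ?thesis by (simp add: log_corr_def False)
qed

lemma c_squared_sums:
  assumes r: "0 < r" "r < 1" and \<theta>: "0 \<le> \<theta>"
  shows "(\<lambda>q. (cmod (c N \<theta> q \<omega>))\<^sup>2 * r ^ q) sums (\<Sum>q. (cmod (c N \<theta> q \<omega>))\<^sup>2 * r ^ q)"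
  using gmc_approx_mass_sums[of "sqrt r" \<theta> N \<omega>] assms
  by (simp add: power_mult sums_iff)

text \<open>The constant test function is evaluated along radii whose squares are
  \<open>exp (- j / n)\<close>, the square being what Parseval produces.\<close>

lemma (in prob_space) laplace_tendsto_in_prob:
  assumes \<theta>: "\<theta> > 0" and GMC: "is_GMC M N \<theta> GMC" and j: "j > 0"
  shows "tendsto_in_prob M
    (\<lambda>n \<omega>. log_corr \<theta> (real n) / real n powr \<theta> * (\<Sum>q. (cmod (c N \<theta> q \<omega>))\<^sup>2 * exp (- j / real n) ^ q))
    (\<lambda>\<omega>. j powr (- \<theta>) * total_mass GMC \<omega>) sequentially"
proof -
  define I where "I = (\<lambda>r \<omega>. \<integral>t. (1::real) \<partial>gmc_approx N \<theta> r \<omega>)"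
  define r where "r n = exp (- j / (2 * real n))" for n
  \<comment> \<open>The normalisation wanted at \<open>n\<close>, divided by the one already built
    into \<open>gmc_approx\<close> at radius \<open>r n\<close>.\<close>
  define \<rho> where "\<rho> n = (log_corr \<theta> (real n) / real n powr \<theta>) /
      (log_corr \<theta> (1 / (1 - (r n)\<^sup>2)) * (1 - (r n)\<^sup>2) powr \<theta>)" for n
  have "tendsto_in_prob M I (\<lambda>\<omega>. \<integral>t. 1 \<partial>GMC \<omega>) (at_left 1)"
    using GMC continuous_on_const[of "sphere 0 1" "1::real"] unfolding is_GMC_def I_def by blast
  moreover have "filterlim r (at_left 1) sequentially"
    unfolding r_def using j by real_asymp
  ultimately have "tendsto_in_prob M (\<lambda>n. I (r n)) (\<lambda>\<omega>. \<integral>t. 1 \<partial>GMC \<omega>) sequentially"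
    by (rule tendsto_in_prob_compose)
  moreover have "(\<lambda>n. \<rho> n * (1 / (2 * pi))) \<longlonglongrightarrow> j powr (- \<theta>) * (1 / (2 * pi))"
    unfolding \<rho>_def r_def by (intro tendsto_intros normalisation_ratio_tendsto j)
  ultimately have lim: "tendsto_in_prob M (\<lambda>n \<omega>. \<rho> n * (1 / (2 * pi)) * I (r n) \<omega>)
      (\<lambda>\<omega>. j powr (- \<theta>) * (1 / (2 * pi)) * (\<integral>t. 1 \<partial>GMC \<omega>)) sequentially"
    by (rule tendsto_in_prob_mult)
  show ?thesis
  proof (rule tendsto_in_prob_cong[OF lim])
    show "\<forall>\<^sub>F n in sequentially. \<forall>\<omega>\<in>space M. \<rho> n * (1 / (2 * pi)) * I (r n) \<omega> =
        log_corr \<theta> (real n) / real n powr \<theta> * (\<Sum>q. (cmod (c N \<theta> q \<omega>))\<^sup>2 * exp (- j / real n) ^ q)"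
      \<comment> \<open>At \<open>n = 0\<close> division by zero would give radius 1, outside the
        range of Parseval.\<close>
      using eventually_gt_at_top[of 0]
    proof eventually_elim
      case (elim n)
      then have r: "0 < r n" "r n < 1" using j by (auto simp: r_def)
      have r2: "(r n)\<^sup>2 = exp (- j / real n)"
        by (simp add: r_def power2_eq_square flip: exp_add)
      show ?case
      proof
        fix \<omega>
        have "(\<Sum>q. (cmod (c N \<theta> q \<omega>))\<^sup>2 * exp (- j / real n) ^ q)
            = I (r n) \<omega> / (2 * pi) / (log_corr \<theta> (1 / (1 - (r n)\<^sup>2)) * (1 - (r n)\<^sup>2) powr \<theta>)"
          using gmc_approx_mass_sums[OF r, of \<theta> N \<omega>] \<theta>
          unfolding sums_iff power_mult r2 log_corr_def I_def by simp
        then show "\<rho> n * (1 / (2 * pi)) * I (r n) \<omega> =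
          log_corr \<theta> (real n) / real n powr \<theta> * (\<Sum>q. (cmod (c N \<theta> q \<omega>))\<^sup>2 * exp (- j / real n) ^ q)"
          by (simp add: \<rho>_def)
      qed
    qed
    fix \<omega> assume "\<omega> \<in> space M"
    then have "sets (GMC \<omega>) = sets (restrict_space borel {0..<2 * pi})"
      using GMC by (simp add: is_GMC_def random_measure_def)
    then have "space (GMC \<omega>) = {0..<2 * pi}"
      by (auto dest: sets_eq_imp_space_eq simp: space_restrict_space)
    then show "j powr (- \<theta>) * (1 / (2 * pi)) * (\<integral>t. 1 \<partial>GMC \<omega>) = j powr (- \<theta>) * total_mass GMC \<omega>"
      by (simp add: total_mass_def)
  qed
qed

text \<open>By linearity it suffices to treat each \<open>Suc i\<close>, where the Laplace limit
  \<open>Suc i powr (- \<theta>)\<close> is the \<open>i\<close>-th moment of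
  \<open>gamma_measure \<theta>\<close> divided by \<open>Gamma \<theta>\<close>. Since
  \<open>Gamma (\<theta> + 1) = \<theta> * Gamma \<theta>\<close>, the factor
  \<open>\<theta>\<close> is left over.\<close>

lemma (in prob_space) polynomial_tendsto_in_prob:
  fixes a :: "nat \<Rightarrow> real"
  assumes \<theta>: "\<theta> > 0" and GMC: "is_GMC M N \<theta> GMC"
  defines "K \<equiv> \<lambda>n. log_corr \<theta> (real n) * (Gamma (\<theta> + 1) / real n powr \<theta>)"
  shows "tendsto_in_prob M
    (\<lambda>n \<omega>. K n * (\<Sum>i\<le>d. a i * (\<Sum>q. (cmod (c N \<theta> q \<omega>))\<^sup>2 * exp (- real (Suc i) / real n) ^ q)))
    (\<lambda>\<omega>. \<theta> * (\<integral>x. (\<Sum>i\<le>d. a i * exp (- x) ^ i) \<partial>gamma_measure \<theta>) * total_mass GMC \<omega>) sequentially"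
proof -
  let ?S = "\<lambda>i n \<omega>. \<Sum>q. (cmod (c N \<theta> q \<omega>))\<^sup>2 * exp (- real (Suc i) / real n) ^ q"
  have "tendsto_in_prob M
    (\<lambda>n \<omega>. \<Sum>i\<le>d. (Gamma (\<theta> + 1) * a i) * (log_corr \<theta> (real n) / real n powr \<theta> * ?S i n \<omega>))
    (\<lambda>\<omega>. \<Sum>i\<le>d. (Gamma (\<theta> + 1) * a i) * (real (Suc i) powr (- \<theta>) * total_mass GMC \<omega>)) sequentially"
    by (intro tendsto_in_prob_sum tendsto_in_prob_mult laplace_tendsto_in_prob tendsto_const \<theta> GMC) auto
  moreover have "(\<integral>x. (\<Sum>i\<le>d. a i * exp (- x) ^ i) \<partial>gamma_measure \<theta>)
      = (\<Sum>i\<le>d. a i * (Gamma \<theta> * real (Suc i) powr (- \<theta>)))"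
    by (intro has_bochner_integral_integral_eq has_bochner_integral_sum
        has_bochner_integral_mult_right moment_gamma_measure \<theta>)
  moreover have "Gamma (\<theta> + 1) = \<theta> * Gamma \<theta>"
    using \<theta> by (intro Gamma_plus1) (auto dest: nonpos_Ints_nonpos)
  ultimately show ?thesis
    by (simp add: K_def sum_distrib_left sum_distrib_right mult_ac del: of_nat_Suc)
qed

text \<open>The non-strict comparison in \<open>trunc_inverse\<close> keeps the term
  \<open>q = n\<close>, so the cutoff matches the inclusive upper limit of the sum.\<close>

lemma partial_sum_sums_trunc_inverse:
  fixes A :: "nat \<Rightarrow> real"
  assumes "n > 0"
  defines "x \<equiv> exp (- 1 / real n)"
  shows "(\<lambda>q. A q * x ^ q * trunc_inverse (x ^ q)) sums (\<Sum>q=0..n. A q)"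
proof -
  have "A q * x ^ q * trunc_inverse (x ^ q) = (if q \<in> {0..n} then A q else 0)" for q
  proof -
    have xq: "x ^ q = exp (- (real q / real n))"
      by (simp add: x_def exp_of_nat_mult[symmetric])
    have "exp (- 1) \<le> x ^ q \<longleftrightarrow> q \<le> n"
      unfolding xq using assms(1) by (simp add: divide_le_eq)
    then show ?thesis by (simp add: trunc_inverse_def x_def)
  qed
  then show ?thesis
    using sums_If_finite_set[of "{0..n}" A] by simp
qed

text \<open>The powers combine as \<open>x ^ q * (x ^ q) ^ i = exp (- (i + 1) / n) ^ q\<close>, and
  each of the finitely many resulting series converges by Parseval.\<close>

lemma polynomial_sums:
  fixes a :: "nat \<Rightarrow> real"
  assumes n: "n > 0" and \<theta>: "0 \<le> \<theta>"
  defines "x \<equiv> exp (- 1 / real n)"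
  shows "(\<lambda>q. (cmod (c N \<theta> q \<omega>))\<^sup>2 * x ^ q * (\<Sum>i\<le>d. a i * (x ^ q) ^ i)) sums
    (\<Sum>i\<le>d. a i * (\<Sum>q. (cmod (c N \<theta> q \<omega>))\<^sup>2 * exp (- real (Suc i) / real n) ^ q))"
proof -
  have "(\<lambda>q. \<Sum>i\<le>d. a i * ((cmod (c N \<theta> q \<omega>))\<^sup>2 * exp (- real (Suc i) / real n) ^ q)) sums
    (\<Sum>i\<le>d. a i * (\<Sum>q. (cmod (c N \<theta> q \<omega>))\<^sup>2 * exp (- real (Suc i) / real n) ^ q))"
    using n \<theta> by (intro sums_sum sums_mult c_squared_sums) (auto simp: divide_less_0_iff)
  moreover have "exp (- real (Suc i) / real n) ^ q = x ^ q * (x ^ q) ^ i" for i q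
  proof -
    have "exp (- real (Suc i) / real n) = x ^ Suc i"
      unfolding x_def exp_of_nat_mult[symmetric] by (simp del: of_nat_Suc)
    then show ?thesis by (simp add: power_mult_distrib power_mult[symmetric] mult.commute)
  qed
  ultimately show ?thesis
    by (simp add: sum_distrib_left mult_ac)
qed

section \<open>Squeezing the partial sums between polynomial weights\<close>

theorem lemma1p9:
  fixes M :: "'a measure" and N :: "nat \<Rightarrow> 'a \<Rightarrow> complex"
    and \<theta> :: real and GMC :: "'a \<Rightarrow> real measure"
  assumes "prob_space M"
    and "iid_std_complex_normal M N"
    and "0 < \<theta>" and "\<theta> \<le> 1"
    and "is_GMC M N \<theta> GMC"
  shows "tendsto_in_prob M (approx_mass N \<theta>) (total_mass GMC) sequentially"
proof -
  interpret prob_space M by fact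
  note \<theta> = \<open>0 < \<theta>\<close>
  have mN: "N k \<in> borel_measurable M" if "k \<ge> 1" for k
    using assms(2) that by (auto simp: iid_std_complex_normal_def indep_vars_def)
  define K where "K n = log_corr \<theta> (real n) * (Gamma (\<theta> + 1) / real n powr \<theta>)" for n
  define T where "T a d n \<omega> =
      K n * (\<Sum>i\<le>d. a i * (\<Sum>q. (cmod (c N \<theta> q \<omega>))\<^sup>2 * exp (- real (Suc i) / real n) ^ q))"
    for a :: "nat \<Rightarrow> real" and d n \<omega>
  let ?J = "\<lambda>a d. \<integral>x. (\<Sum>i\<le>d. a i * exp (- x) ^ i) \<partial>gamma_measure \<theta>"
  have T: "tendsto_in_prob M (T a d) (\<lambda>\<omega>. \<theta> * ?J a d * total_mass GMC \<omega>) sequentially" for a d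
    unfolding T_def[abs_def] K_def by (rule polynomial_tendsto_in_prob[OF \<theta> assms(5)])
  have approx: "approx_mass N \<theta> n \<omega> = K n * (\<Sum>q=0..n. (cmod (c N \<theta> q \<omega>))\<^sup>2)" for n \<omega>
    by (simp add: approx_mass_def K_def log_corr_def)
  have K0: "K n \<ge> 0" if "n > 0" for n
    using that \<theta> by (simp add: K_def log_corr_def Gamma_real_pos less_imp_le)
  \<comment> \<open>The target integral is \<open>1 / \<theta>\<close>, so after multiplication by
    \<open>\<theta>\<close> the limiting factors lie near 1; hence the tolerance
    \<open>e / \<theta>\<close> for the sandwich.\<close>
  have J: "\<bar>\<theta> * y - 1\<bar> \<le> e" if "\<bar>y - 1 / \<theta>\<bar> \<le> e / \<theta>" for y e
  proof -
    have "\<bar>\<theta> * y - 1\<bar> = \<theta> * \<bar>y - 1 / \<theta>\<bar>"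
      using \<theta> abs_mult[of \<theta> "y - 1 / \<theta>"] by (simp add: right_diff_distrib)
    also have "\<dots> \<le> \<theta> * (e / \<theta>)" using \<theta> that by (intro mult_left_mono) auto
    finally show ?thesis using \<theta> by simp
  qed
  show ?thesis
  proof (rule tendsto_in_prob_squeeze)
    have [measurable]: "c N \<theta> q \<in> borel_measurable M" for q
      by (rule measurable_c[OF mN])
    have "approx_mass N \<theta> n \<in> borel_measurable M" for n
      unfolding approx_mass_def[abs_def] by measurable
    then show "\<forall>\<^sub>F n in sequentially. approx_mass N \<theta> n \<in> borel_measurable M" by simp
    have "{0..<2 * pi} \<in> sets (restrict_space borel {0..<2 * pi})"
      by (simp add: sets_restrict_space_iff)
    then have [measurable]: "(\<lambda>\<omega>. emeasure (GMC \<omega>) {0..<2 * pi}) \<in> borel_measurable M"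
      using assms(5) by (simp add: is_GMC_def random_measure_def)
    show "total_mass GMC \<in> borel_measurable M"
      unfolding total_mass_def[abs_def] measure_def by measurable
  next
    fix e :: real assume "e > 0"
    then have "e / \<theta> > 0" using \<theta> by simp
    then obtain a b :: "nat \<Rightarrow> real" and d d' where
      a: "\<And>x. x \<in> {0..1} \<Longrightarrow> (\<Sum>i\<le>d. a i * x ^ i) \<le> trunc_inverse x" and
      b: "\<And>x. x \<in> {0..1} \<Longrightarrow> trunc_inverse x \<le> (\<Sum>i\<le>d'. b i * x ^ i)" and
      Ja: "\<bar>?J a d - 1 / \<theta>\<bar> \<le> e / \<theta>" and Jb: "\<bar>?J b d' - 1 / \<theta>\<bar> \<le> e / \<theta>"
      by (rule polynomial_sandwich_trunc_inverse[OF \<theta>]) (rule that)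
    have sq: "\<forall>\<^sub>F n in sequentially. \<forall>\<omega>\<in>space M.
        T a d n \<omega> \<le> approx_mass N \<theta> n \<omega> \<and> approx_mass N \<theta> n \<omega> \<le> T b d' n \<omega>"
      using eventually_gt_at_top[of 0]
    proof (eventually_elim, intro ballI)
      fix n :: nat and \<omega> assume n: "0 < n"
      define x where "x = exp (- 1 / real n)"
      let ?A = "\<lambda>q. (cmod (c N \<theta> q \<omega>))\<^sup>2"
      have xq: "x ^ q \<in> {0..1}" for q
        by (simp add: x_def power_le_one)
      have nn: "0 \<le> ?A q * x ^ q" for q by (simp add: x_def)
      note poly = polynomial_sums[OF n less_imp_le[OF \<theta>], folded x_def]
        and part = partial_sum_sums_trunc_inverse[OF n, of ?A, folded x_def]
      \<comment> \<open>The sandwich is used at the points \<open>x ^ q\<close> of the unit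
        interval; nonnegativity of \<open>?A q * x ^ q\<close> preserves the inequalities
        termwise.\<close>
      have "(\<Sum>i\<le>d. a i * (\<Sum>q. ?A q * exp (- real (Suc i) / real n) ^ q)) \<le> (\<Sum>q=0..n. ?A q)"
        by (rule sums_le[OF mult_left_mono[OF a[OF xq] nn] poly part])
      moreover have "(\<Sum>q=0..n. ?A q) \<le> (\<Sum>i\<le>d'. b i * (\<Sum>q. ?A q * exp (- real (Suc i) / real n) ^ q))"
        by (rule sums_le[OF mult_left_mono[OF b[OF xq] nn] part poly])
      ultimately show "T a d n \<omega> \<le> approx_mass N \<theta> n \<omega> \<and> approx_mass N \<theta> n \<omega> \<le> T b d' n \<omega>"
        unfolding T_def approx using K0[OF n] by (simp add: mult_left_mono)
    qed
    show "\<exists>U V \<alpha> \<beta>. \<bar>\<alpha> - 1\<bar> \<le> e \<and> \<bar>\<beta> - 1\<bar> \<le> e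
      \<and> tendsto_in_prob M U (\<lambda>\<omega>. \<alpha> * total_mass GMC \<omega>) sequentially
      \<and> tendsto_in_prob M V (\<lambda>\<omega>. \<beta> * total_mass GMC \<omega>) sequentially
      \<and> (\<forall>\<^sub>F n in sequentially. \<forall>\<omega>\<in>space M. U n \<omega> \<le> approx_mass N \<theta> n \<omega> \<and> approx_mass N \<theta> n \<omega> \<le> V n \<omega>)"
      by (rule exI[of _ "T a d"], rule exI[of _ "T b d'"], rule exI[of _ "\<theta> * ?J a d"], rule exI[of _ "\<theta> * ?J b d'"])
         (intro conjI J Ja Jb T sq)
  qed
qed

end
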